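(* Let $(n_m)_{m\ge 1}$ and $(T_m)_{m\ge 1}$ be sequences of positive integers tending to infinity, and for each $m$ let $\Sigma_m$ be an $n_m\times n_m$ real symmetric positive semidefinite matrix with $\operatorname{Tr}\Sigma_m>0$. Let $q_m:=n_m/T_m$. Suppose that $q_m$, the operator norm $\|\Sigma_m\|$, and $T_m/\operatorname{Tr}\Sigma_m$ all stay bounded as $m\to\infty$. Let $\mathbf{X}_m\in\mathbb{R}^{n_m\times T_m}$ be a random matrix whose $T_m$ columns are independent centered Gaussian vectors in $\mathbb{R}^{n_m}$ with covariance $\Sigma_m$. Let $L_m$ and $G_m$ be the random functions defined in the context. Then for any fixed $z\in\mathbb{C}\setminus\mathbb{R}$, $$L_m(z)=1-\frac{1}{1-q_m+zG_m(z)}+o(1),$$ where $o(1)$ denotes a random variable tending to zero in probability as $m\to\infty$.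
   Context: $M'$ denotes the transpose of a real matrix $M$, and $\|M\|$ its operator norm with respect to the canonical Euclidean norms. The empirical covariance estimator is $\mathbf{E}_m:=\frac{1}{T_m}\mathbf{X}_m\mathbf{X}_m'\in\mathbb{R}^{n_m\times n_m}$, and its resolvent is $\mathbf{G}_m(z):=(z-\mathbf{E}_m)^{-1}$ for $z\in\mathbb{C}\setminus\mathbb{R}$. Define $$L_m(z):=\frac{1}{T_m}\operatorname{Tr}\big(\mathbf{G}_m(z)\Sigma_m\big),\qquad G_m(z):=\frac{1}{T_m}\operatorname{Tr}\mathbf{G}_m(z).$$ Note that both traces are normalized by $T_m$, not by $n_m$. No relation is assumed between the matrices for different values of $m$. *)

theory Defs
  imports "HOL-Probability.Probability" "Jordan_Normal_Form.Gauss_Jordan_Elimination"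
begin

unbundle no inner_syntax
no_notation vec_nth (infixl \<open>$\<close> 90)
hide_const (open) Finite_Cartesian_Product.vec Finite_Cartesian_Product.mat

definition mat_trace :: "'a::comm_monoid_add mat \<Rightarrow> 'a" where
  "mat_trace A = (\<Sum>i<dim_row A. A $$ (i, i))"

definition euclid_norm :: "real vec \<Rightarrow> real" where
  "euclid_norm v = sqrt (v \<bullet> v)"

definition op_norm :: "real mat \<Rightarrow> real" where
  "op_norm A = (SUP v \<in> {v \<in> carrier_vec (dim_col A). euclid_norm v \<le> 1}. euclid_norm (A *\<^sub>v v))"

definition symmetric_mat :: "real mat \<Rightarrow> bool" where
  "symmetric_mat A \<longleftrightarrow> square_mat A \<and> A\<^sup>T = A"

definition pos_semidef_mat :: "real mat \<Rightarrow> bool" where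
  "pos_semidef_mat A \<longleftrightarrow> symmetric_mat A \<and> (\<forall>v \<in> carrier_vec (dim_row A). 0 \<le> v \<bullet> (A *\<^sub>v v))"

(* Point masses count as Gaussian (variance 0), because a covariance matrix may be singular. *)
definition gaussian_rv :: "'w measure \<Rightarrow> ('w \<Rightarrow> real) \<Rightarrow> bool" where
  "gaussian_rv M Y \<longleftrightarrow> Y \<in> borel_measurable M \<and>
     (\<exists>\<mu> \<sigma>. \<sigma> \<ge> 0 \<and>
        distr M borel Y = (if \<sigma> = 0 then return borel \<mu> else density lborel (normal_density \<mu> \<sigma>)))"

(* For u ranging over the unit vectors this includes measurability of the coordinates of Y. *)
definition gaussian_vec :: "'w measure \<Rightarrow> nat \<Rightarrow> ('w \<Rightarrow> real vec) \<Rightarrow> bool" where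
  "gaussian_vec M n Y \<longleftrightarrow> (\<forall>\<omega> \<in> space M. Y \<omega> \<in> carrier_vec n) \<and>
     (\<forall>u \<in> carrier_vec n. gaussian_rv M (\<lambda>\<omega>. u \<bullet> Y \<omega>))"

definition mean_vec :: "'w measure \<Rightarrow> nat \<Rightarrow> ('w \<Rightarrow> real vec) \<Rightarrow> real vec" where
  "mean_vec M n Y = vec n (\<lambda>i. integral\<^sup>L M (\<lambda>\<omega>. Y \<omega> $ i))"

definition covariance_mat :: "'w measure \<Rightarrow> nat \<Rightarrow> ('w \<Rightarrow> real vec) \<Rightarrow> real mat" where
  "covariance_mat M n Y = mat n n (\<lambda>(i, j). integral\<^sup>L M
     (\<lambda>\<omega>. (Y \<omega> $ i - mean_vec M n Y $ i) * (Y \<omega> $ j - mean_vec M n Y $ j)))"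

(* Columns are passed to indep_vars as extensional functions on {..<n}, since the type of
   vectors carries no sigma-algebra. *)
definition gaussian_columns ::
    "'w measure \<Rightarrow> nat \<Rightarrow> nat \<Rightarrow> real mat \<Rightarrow> ('w \<Rightarrow> real mat) \<Rightarrow> bool" where
  "gaussian_columns M n T \<Sigma> X \<longleftrightarrow>
     (\<forall>\<omega> \<in> space M. X \<omega> \<in> carrier_mat n T) \<and>
     (\<forall>t<T. gaussian_vec M n (\<lambda>\<omega>. col (X \<omega>) t) \<and>
            mean_vec M n (\<lambda>\<omega>. col (X \<omega>) t) = 0\<^sub>v n \<and>
            covariance_mat M n (\<lambda>\<omega>. col (X \<omega>) t) = \<Sigma>) \<and>
     prob_space.indep_vars M (\<lambda>t. PiM {..<n} (\<lambda>i. borel))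
       (\<lambda>t \<omega>. \<lambda>i\<in>{..<n}. col (X \<omega>) t $ i) {..<T}"

definition empirical_cov :: "nat \<Rightarrow> real mat \<Rightarrow> real mat" where
  "empirical_cov T X = (1 / real T) \<cdot>\<^sub>m (X * X\<^sup>T)"

(* z - E is invertible for real symmetric E and non-real z, so mat_inverse is not None there. *)
definition resolvent :: "real mat \<Rightarrow> complex \<Rightarrow> complex mat" where
  "resolvent E z = the (mat_inverse (z \<cdot>\<^sub>m 1\<^sub>m (dim_row E) - map_mat complex_of_real E))"

definition L_fun :: "nat \<Rightarrow> real mat \<Rightarrow> real mat \<Rightarrow> complex \<Rightarrow> complex" where
  "L_fun T \<Sigma> X z =
     1 / of_nat T * mat_trace (resolvent (empirical_cov T X) z * map_mat complex_of_real \<Sigma>)"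

definition G_fun :: "nat \<Rightarrow> real mat \<Rightarrow> complex \<Rightarrow> complex" where
  "G_fun T X z = 1 / of_nat T * mat_trace (resolvent (empirical_cov T X) z)"

(* Convergence to zero in probability of random variables indexed by m >= 1, each on its own
   probability space. *)
definition tendsto_zero_in_prob :: "(nat \<Rightarrow> 'w measure) \<Rightarrow> (nat \<Rightarrow> 'w \<Rightarrow> complex) \<Rightarrow> bool" where
  "tendsto_zero_in_prob M Z \<longleftrightarrow>
     (\<forall>m\<ge>1. Z m \<in> borel_measurable (M m)) \<and>
     (\<forall>\<epsilon>>0. (\<lambda>m. measure (M m) {\<omega> \<in> space (M m). cmod (Z m \<omega>) > \<epsilon>}) \<longlonglongrightarrow> 0)"

end

theory Submission
  imports Defs "Jordan_Normal_Form.Determinant"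
begin

hide_const (open) Determinants.det

text \<open>
  Leave-one-out argument. Write \<open>H\<close> for the resolvent after removing the column \<open>x\<close> with index \<open>t\<close>, and
  \<open>a = x' H x / T\<close>. The rank-one update formula gives \<open>1 - q + z G = (1/T) \<Sum> 1 / (1 - a)\<close>, summed
  over the columns, and \<open>1 / \<bar>1 - a\<bar> \<le> \<bar>z\<bar> / \<bar>Im z\<bar>\<close> because \<open>Im (z (1 - a))\<close> has the sign of \<open>Im z\<close> and at
  least its modulus. Hence \<open>(1 - q + z G) (1 - L) - 1\<close> is bounded by the average of \<open>\<bar>a - L\<bar>\<close>. Removing one
  column changes \<open>L\<close> by \<open>O(1/T)\<close>, and as \<open>x\<close> is independent of \<open>H\<close>, the fourth moments of a Gaussian vector
  show that \<open>a - Tr (H \<Sigma>) / T\<close> has second moment at most \<open>2 n \<parallel>\<Sigma>\<parallel>\<^sup>2 / (Im z)\<^sup>2 T\<^sup>2\<close>, which is \<open>O(1/T)\<close>.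
\<close>

subsection \<open>Operator norm\<close>

text \<open>The quantity 1 - q + z G is z / T times the trace of the resolvent of the companion
  matrix X'X / T, whose spectrum differs from that of XX' / T only by zeros. The numbers 1 / (1 - a)
  are the diagonal entries of z times that resolvent, which is the origin of the leave-one-out
  identity. The obstacle is that no lower bound on the modulus of 1 - q + z G is at hand, although
  the theorem divides by it. So the product with 1 - L is compared with 1 first. Once it is close to
  1, the reciprocal is at most 2 |1 - L|, and L is bounded by q |Im z|^(-1) times the norm of
  \<Sigma>. All this holds for every outcome. The norm of x is never estimated, because 1 - a itself
  controls the norm of H x. Probability enters only through one second moment per column, and since
  the columns enter through an average, Markov's inequality for that average suffices and nothing
  uniform in the columns is sought.\<close>

lemma euclid_norm_sq: "(euclid_norm v)\<^sup>2 = (\<Sum>i<dim_vec v. (v $ i)\<^sup>2)"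
proof -
  have "v \<bullet> v = (\<Sum>i<dim_vec v. (v $ i)\<^sup>2)"
    by (simp add: scalar_prod_def power2_eq_square lessThan_atLeast0)
  then show ?thesis
    by (simp add: euclid_norm_def sum_nonneg)
qed

lemma euclid_norm_nonneg [simp]: "euclid_norm v \<ge> 0"
  using euclid_norm_sq[of v] unfolding euclid_norm_def
  by (simp add: scalar_prod_def sum_nonneg)

lemma euclid_norm_smult: "euclid_norm (c \<cdot>\<^sub>v v) = \<bar>c\<bar> * euclid_norm v"
proof -
  have "(euclid_norm (c \<cdot>\<^sub>v v))\<^sup>2 = (\<bar>c\<bar> * euclid_norm v)\<^sup>2"
    by (simp add: euclid_norm_sq power_mult_distrib sum_distrib_left)
  then show ?thesis
    by (simp add: power2_eq_iff_nonneg)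
qed

text \<open>Cauchy-Schwarz row by row. This crude constant makes the supremum in
  \<open>op_norm\<close> finite and settles vectors of norm zero, which cannot be
  normalised.\<close>

lemma euclid_norm_mult_mat_vec_frobenius:
  assumes "S \<in> carrier_mat m n" "v \<in> carrier_vec n"
  shows "(euclid_norm (S *\<^sub>v v))\<^sup>2 \<le> (\<Sum>i<m. \<Sum>j<n. (S $$ (i, j))\<^sup>2) * (euclid_norm v)\<^sup>2"
proof -
  have "(euclid_norm (S *\<^sub>v v))\<^sup>2 = (\<Sum>i<m. (\<Sum>j<n. S $$ (i, j) * v $ j)\<^sup>2)"
    using assms by (auto simp: euclid_norm_sq scalar_prod_def lessThan_atLeast0 intro!: sum.cong)
  also have "\<dots> \<le> (\<Sum>i<m. (\<Sum>j<n. (S $$ (i, j))\<^sup>2) * (\<Sum>j<n. (v $ j)\<^sup>2))"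
    by (intro sum_mono Cauchy_Schwarz_ineq_sum)
  finally show ?thesis
    using assms by (simp add: euclid_norm_sq sum_distrib_right)
qed

text \<open>The supremum of an unbounded set of reals carries no information, so
  \<open>op_norm\<close> bounds anything only once its set of values is known to be bounded.\<close>

lemma op_norm_bdd_above:
  "bdd_above ((\<lambda>v. euclid_norm (S *\<^sub>v v)) ` {v \<in> carrier_vec (dim_col S). euclid_norm v \<le> 1})"
proof (intro bdd_aboveI2)
  fix v assume v: "v \<in> {v \<in> carrier_vec (dim_col S). euclid_norm v \<le> 1}"
  define c where "c = (\<Sum>i<dim_row S. \<Sum>j<dim_col S. (S $$ (i, j))\<^sup>2)"
  have c: "c \<ge> 0" unfolding c_def by (intro sum_nonneg) auto
  have "(euclid_norm (S *\<^sub>v v))\<^sup>2 \<le> c * (euclid_norm v)\<^sup>2"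
    unfolding c_def using v by (intro euclid_norm_mult_mat_vec_frobenius) auto
  also have "\<dots> \<le> c * 1"
    using v c by (intro mult_left_mono power_le_one) auto
  finally show "euclid_norm (S *\<^sub>v v) \<le> sqrt c"
    by (simp add: real_le_rsqrt)
qed

lemma op_norm_nonneg: "op_norm S \<ge> 0"
proof -
  have "euclid_norm (S *\<^sub>v 0\<^sub>v (dim_col S)) \<le> op_norm S"
    unfolding op_norm_def by (rule cSUP_upper[OF _ op_norm_bdd_above]) (simp add: euclid_norm_def)
  then show ?thesis
    using euclid_norm_nonneg order_trans by blast
qed

lemma euclid_norm_mult_mat_vec_le:
  assumes S: "S \<in> carrier_mat m n" and v: "v \<in> carrier_vec n"
  shows "euclid_norm (S *\<^sub>v v) \<le> op_norm S * euclid_norm v"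
proof (cases "euclid_norm v = 0")
  case True
  then show ?thesis
    using euclid_norm_mult_mat_vec_frobenius[OF S v] by simp
next
  case False
  define u where "u = (1 / euclid_norm v) \<cdot>\<^sub>v v"
  have u: "u \<in> carrier_vec (dim_col S)" "euclid_norm u \<le> 1"
    using assms False by (auto simp: u_def euclid_norm_smult)
  have "euclid_norm (S *\<^sub>v u) \<le> op_norm S"
    unfolding op_norm_def by (rule cSUP_upper[OF _ op_norm_bdd_above]) (use u in simp)
  moreover have "S *\<^sub>v u = (1 / euclid_norm v) \<cdot>\<^sub>v (S *\<^sub>v v)"
    unfolding u_def by (rule mult_mat_vec[OF S v])
  moreover have "euclid_norm v > 0"
    using False euclid_norm_nonneg[of v] by linarith
  ultimately show ?thesis
    by (simp add: euclid_norm_smult field_simps)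
qed

text \<open>\<open>op_norm\<close> is a supremum over real vectors. As S is real, it acts separately
  on real and imaginary parts, whose squared norms add up, so the same constant serves complex
  vectors.\<close>

lemma op_norm_complex_bound:
  fixes w :: "nat \<Rightarrow> complex"
  assumes S: "S \<in> carrier_mat m n"
  shows "(\<Sum>i<m. (cmod (\<Sum>j<n. of_real (S $$ (i, j)) * w j))\<^sup>2) \<le> (op_norm S)\<^sup>2 * (\<Sum>j<n. (cmod (w j))\<^sup>2)"
proof -
  have real: "(\<Sum>i<m. (\<Sum>j<n. S $$ (i, j) * f j)\<^sup>2) \<le> (op_norm S)\<^sup>2 * (\<Sum>j<n. (f j)\<^sup>2)" for f
  proof -
    have "(\<Sum>i<m. (\<Sum>j<n. S $$ (i, j) * f j)\<^sup>2) = (euclid_norm (S *\<^sub>v vec n f))\<^sup>2"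
      using S by (auto simp: euclid_norm_sq scalar_prod_def lessThan_atLeast0 intro!: sum.cong)
    also have "\<dots> \<le> (op_norm S * euclid_norm (vec n f))\<^sup>2"
      using euclid_norm_mult_mat_vec_le[OF S, of "vec n f"] by (intro power_mono) auto
    finally show ?thesis by (simp add: power_mult_distrib euclid_norm_sq)
  qed
  have "(\<Sum>i<m. (cmod (\<Sum>j<n. of_real (S $$ (i, j)) * w j))\<^sup>2)
      = (\<Sum>i<m. (\<Sum>j<n. S $$ (i, j) * Re (w j))\<^sup>2) + (\<Sum>i<m. (\<Sum>j<n. S $$ (i, j) * Im (w j))\<^sup>2)"
    by (simp add: cmod_power2 sum.distrib)
  also have "\<dots> \<le> (op_norm S)\<^sup>2 * (\<Sum>j<n. (Re (w j))\<^sup>2) + (op_norm S)\<^sup>2 * (\<Sum>j<n. (Im (w j))\<^sup>2)"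
    by (intro add_mono real)
  finally show ?thesis
    by (simp add: cmod_power2 sum.distrib distrib_left)
qed

text \<open>With B read as a matrix, the form pairs it entrywise with C = S (cnj B) S'. Applying S
  along one index and then along the other multiplies the Frobenius norm by at most
  \<open>op_norm S\<close> each time, and Cauchy-Schwarz finishes. Using the operator norm of S here
  keeps the final variance linear in n.\<close>

lemma op_norm_frobenius_form:
  fixes B :: "nat \<Rightarrow> nat \<Rightarrow> complex"
  assumes S: "S \<in> carrier_mat n n"
  shows "cmod (\<Sum>i<n. \<Sum>j<n. \<Sum>k<n. \<Sum>l<n. of_real (S $$ (i, k) * S $$ (j, l)) * (B i j * cnj (B k l)))
    \<le> (op_norm S)\<^sup>2 * (\<Sum>i<n. \<Sum>j<n. (cmod (B i j))\<^sup>2)"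
proof -
  define F where "F = (\<Sum>i<n. \<Sum>j<n. (cmod (B i j))\<^sup>2)"
  define C where "C i j = (\<Sum>k<n. of_real (S $$ (i, k)) * (\<Sum>l<n. of_real (S $$ (j, l)) * cnj (B k l)))" for i j
  have "(\<Sum>i<n. \<Sum>j<n. (cmod (C i j))\<^sup>2) = (\<Sum>j<n. \<Sum>i<n. (cmod (C i j))\<^sup>2)"
    by (rule sum.swap)
  also have "\<dots> \<le> (\<Sum>j<n. (op_norm S)\<^sup>2 * (\<Sum>k<n. (cmod (\<Sum>l<n. of_real (S $$ (j, l)) * cnj (B k l)))\<^sup>2))"
    unfolding C_def by (intro sum_mono op_norm_complex_bound[OF S])
  also have "\<dots> = (op_norm S)\<^sup>2 * (\<Sum>k<n. \<Sum>j<n. (cmod (\<Sum>l<n. of_real (S $$ (j, l)) * cnj (B k l)))\<^sup>2)"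
    unfolding sum_distrib_left by (rule sum.swap)
  also have "\<dots> \<le> (op_norm S)\<^sup>2 * (\<Sum>k<n. (op_norm S)\<^sup>2 * (\<Sum>l<n. (cmod (cnj (B k l)))\<^sup>2))"
    by (intro mult_left_mono sum_mono op_norm_complex_bound[OF S]) auto
  finally have C: "(\<Sum>i<n. \<Sum>j<n. (cmod (C i j))\<^sup>2) \<le> ((op_norm S)\<^sup>2)\<^sup>2 * F"
    by (simp add: F_def power2_eq_square[of "(op_norm S)\<^sup>2"] mult.assoc flip: sum_distrib_left)
  have F0: "F \<ge> 0" unfolding F_def by (intro sum_nonneg) auto
  have pairs: "(\<Sum>i<n. \<Sum>j<n. f i j) = (\<Sum>p\<in>{..<n} \<times> {..<n}. f (fst p) (snd p))" for f :: "nat \<Rightarrow> nat \<Rightarrow> real"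
    by (simp add: sum.cartesian_product split_def)
  have "(\<Sum>i<n. \<Sum>j<n. \<Sum>k<n. \<Sum>l<n. of_real (S $$ (i, k) * S $$ (j, l)) * (B i j * cnj (B k l)))
      = (\<Sum>i<n. \<Sum>j<n. B i j * C i j)"
    by (simp add: C_def sum_distrib_left mult_ac)
  also have "cmod \<dots> \<le> (\<Sum>i<n. \<Sum>j<n. cmod (B i j) * cmod (C i j))"
    by (intro order_trans[OF norm_sum] sum_mono) (simp add: norm_mult sum_mono)
  finally have "(cmod (\<Sum>i<n. \<Sum>j<n. \<Sum>k<n. \<Sum>l<n. of_real (S $$ (i, k) * S $$ (j, l)) * (B i j * cnj (B k l))))\<^sup>2
     \<le> (\<Sum>i<n. \<Sum>j<n. cmod (B i j) * cmod (C i j))\<^sup>2"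
    by (intro power_mono) auto
  also have "\<dots> \<le> F * (\<Sum>i<n. \<Sum>j<n. (cmod (C i j))\<^sup>2)"
    unfolding F_def pairs by (rule Cauchy_Schwarz_ineq_sum)
  also have "\<dots> \<le> F * (((op_norm S)\<^sup>2)\<^sup>2 * F)"
    using F0 C by (rule mult_left_mono[rotated])
  also have "\<dots> = ((op_norm S)\<^sup>2 * F)\<^sup>2" by (simp add: power2_eq_square)
  finally show ?thesis
    unfolding F_def[symmetric] by (rule power2_le_imp_le) (use F0 in simp)
qed

subsection \<open>Resolvent identities\<close>

text \<open>Setting the column to zero instead of deleting it keeps the dimensions and the factor
  1/T, so the reduced matrix is again an instance of \<open>resolvent_sample\<close> with the same
  parameters.\<close>

definition zero_col :: "real mat \<Rightarrow> nat \<Rightarrow> real mat" where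
  "zero_col X t = mat (dim_row X) (dim_col X) (\<lambda>(i, s). if s = t then 0 else X $$ (i, s))"

text \<open>One fixed outcome of the sample matrix: the statements in this locale are pathwise, and
  the random matrix enters later by interpretation at each outcome.\<close>

locale resolvent_sample =
  fixes n T :: nat and X :: "real mat" and z :: complex
  assumes X: "X \<in> carrier_mat n T" and T: "T > 0" and z: "Im z \<noteq> 0"
begin

definition pencil :: "complex mat" where
  "pencil = z \<cdot>\<^sub>m 1\<^sub>m n - map_mat complex_of_real (empirical_cov T X)"

abbreviation R :: "complex mat" where
  "R \<equiv> resolvent (empirical_cov T X) z"

definition proj :: "nat \<Rightarrow> complex vec \<Rightarrow> complex" where
  "proj t w = (\<Sum>k<n. of_real (X $$ (k, t)) * w $ k)"

lemma dim_X [simp]: "dim_row X = n" "dim_col X = T"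
  using X by auto

lemma dim_empirical_cov [simp]:
  "dim_row (empirical_cov T X) = n" "dim_col (empirical_cov T X) = n"
  by (simp_all add: empirical_cov_def)

lemma pencil_carrier [simp]: "pencil \<in> carrier_mat n n"
  unfolding carrier_mat_def by (simp add: pencil_def)

lemma dim_pencil: "dim_row pencil = n" "dim_col pencil = n"
  using pencil_carrier unfolding carrier_mat_def by blast+

lemma empirical_cov_index:
  assumes "i < n" "j < n"
  shows "empirical_cov T X $$ (i, j) = (\<Sum>t<T. X $$ (i, t) * X $$ (j, t)) / T"
  using assms by (simp add: empirical_cov_def scalar_prod_def lessThan_atLeast0)

lemma pencil_mult_vec:
  assumes "w \<in> carrier_vec n" "i < n"
  shows "(pencil *\<^sub>v w) $ i = z * w $ i - (\<Sum>t<T. of_real (X $$ (i, t)) * proj t w) / T"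
proof -
  have "(pencil *\<^sub>v w) $ i = (\<Sum>k<n. ((if i = k then z else 0) - of_real (empirical_cov T X $$ (i, k))) * w $ k)"
    using assms pencil_carrier unfolding carrier_mat_def
    by (auto simp: scalar_prod_def lessThan_atLeast0 pencil_def intro!: sum.cong)
  also have "\<dots> = z * w $ i - (\<Sum>k<n. of_real (empirical_cov T X $$ (i, k)) * w $ k)"
    using assms by (simp add: left_diff_distrib sum_subtractf if_distrib[of "\<lambda>a. a * _"] cong: if_cong)
  also have "(\<Sum>k<n. of_real (empirical_cov T X $$ (i, k)) * w $ k)
      = (\<Sum>k<n. \<Sum>t<T. of_real (X $$ (i, t)) * (of_real (X $$ (k, t)) * w $ k)) / T"
    using assms by (simp add: empirical_cov_index sum_divide_distrib sum_distrib_right mult.assoc)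
  also have "\<dots> = (\<Sum>t<T. of_real (X $$ (i, t)) * proj t w) / T"
    unfolding proj_def sum_distrib_left by (subst sum.swap) (rule refl)
  finally show ?thesis .
qed

text \<open>The second term is |X'w|^2 / T, hence real, so the imaginary part of the form is Im z
  times |w|^2. All bounds on the resolvent below come from this.\<close>

lemma pencil_form:
  assumes w: "w \<in> carrier_vec n"
  shows "(\<Sum>i<n. (pencil *\<^sub>v w) $ i * cnj (w $ i))
    = z * of_real (\<Sum>i<n. (cmod (w $ i))\<^sup>2) - of_real ((\<Sum>t<T. (cmod (proj t w))\<^sup>2) / T)"
proof -
  have "(\<Sum>i<n. (pencil *\<^sub>v w) $ i * cnj (w $ i))
     = (\<Sum>i<n. z * (w $ i * cnj (w $ i)) - (\<Sum>t<T. of_real (X $$ (i, t)) * proj t w * cnj (w $ i)) / T)"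
    using w by (auto intro!: sum.cong simp: pencil_mult_vec left_diff_distrib sum_distrib_right)
  also have "\<dots> = z * (\<Sum>i<n. w $ i * cnj (w $ i))
      - (\<Sum>i<n. \<Sum>t<T. of_real (X $$ (i, t)) * proj t w * cnj (w $ i)) / T"
    by (simp add: sum_subtractf sum_distrib_left sum_divide_distrib)
  also have "(\<Sum>i<n. \<Sum>t<T. of_real (X $$ (i, t)) * proj t w * cnj (w $ i))
      = (\<Sum>t<T. proj t w * cnj (proj t w))"
  proof -
    have "cnj (proj t w) = (\<Sum>i<n. of_real (X $$ (i, t)) * cnj (w $ i))" for t
      by (simp add: proj_def)
    then show ?thesis
      by (subst sum.swap) (simp add: sum_distrib_left mult_ac)
  qed
  finally show ?thesis by (simp add: of_real_sum complex_norm_square del: of_real_power)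
qed

text \<open>By Cauchy-Schwarz the imaginary part of the form is at most |(z - E) w| |w|, and one
  factor |w| cancels. Read for w = R v, this says that the resolvent has norm at most 1 / |Im
  z|.\<close>

lemma pencil_norm_bound:
  assumes w: "w \<in> carrier_vec n"
  shows "(Im z)\<^sup>2 * (\<Sum>i<n. (cmod (w $ i))\<^sup>2) \<le> (\<Sum>i<n. (cmod ((pencil *\<^sub>v w) $ i))\<^sup>2)"
proof -
  define s where "s = (\<Sum>i<n. (cmod (w $ i))\<^sup>2)"
  define r where "r = (\<Sum>i<n. (cmod ((pencil *\<^sub>v w) $ i))\<^sup>2)"
  have s0: "s \<ge> 0" unfolding s_def by (intro sum_nonneg) auto
  have r0: "r \<ge> 0" unfolding r_def by (intro sum_nonneg) auto
  have "Im (\<Sum>i<n. (pencil *\<^sub>v w) $ i * cnj (w $ i)) = Im z * s"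
    unfolding pencil_form[OF w] s_def by simp
  then have "\<bar>Im z\<bar> * s = \<bar>Im (\<Sum>i<n. (pencil *\<^sub>v w) $ i * cnj (w $ i))\<bar>"
    using s0 by (simp add: abs_mult)
  also have "\<dots> \<le> cmod (\<Sum>i<n. (pencil *\<^sub>v w) $ i * cnj (w $ i))" by (rule abs_Im_le_cmod)
  also have "\<dots> \<le> (\<Sum>i<n. cmod ((pencil *\<^sub>v w) $ i) * cmod (w $ i))"
    by (rule order_trans[OF norm_sum]) (simp add: norm_mult)
  finally have "(\<bar>Im z\<bar> * s)\<^sup>2 \<le> (\<Sum>i<n. cmod ((pencil *\<^sub>v w) $ i) * cmod (w $ i))\<^sup>2"
    using s0 by (intro power_mono) auto
  also have "\<dots> \<le> r * s" unfolding r_def s_def by (rule Cauchy_Schwarz_ineq_sum)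
  finally have "((Im z)\<^sup>2 * s) * s \<le> r * s" by (simp add: power_mult_distrib power2_eq_square[of s] mult.assoc)
  then have "(Im z)\<^sup>2 * s \<le> r"
    using s0 r0 by (cases "s = 0") (auto dest: mult_right_le_imp_le)
  then show ?thesis by (simp add: s_def r_def)
qed

text \<open>\<open>pencil_norm_bound\<close> makes the kernel trivial, so the determinant is nonzero
  and \<open>mat_inverse\<close> does not return \<open>None\<close>: the \<open>the\<close> in
  \<open>resolvent\<close> yields a genuine inverse.\<close>

lemma resolvent_inverse:
  shows R_carrier [simp]: "R \<in> carrier_mat n n"
    and pencil_R: "pencil * R = 1\<^sub>m n" and R_pencil: "R * pencil = 1\<^sub>m n"
proof -
  have "det pencil \<noteq> 0"
  proof
    assume "det pencil = 0"
    then obtain v where v: "v \<in> carrier_vec n" "v \<noteq> 0\<^sub>v n" "pencil *\<^sub>v v = 0\<^sub>v n"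
      using det_0_iff_vec_prod_zero_field[OF pencil_carrier] by blast
    have "(Im z)\<^sup>2 * (\<Sum>i<n. (cmod (v $ i))\<^sup>2) \<le> 0"
      using pencil_norm_bound[OF v(1)] v(3) by simp
    then have "(\<Sum>i<n. (cmod (v $ i))\<^sup>2) \<le> 0" using z by (simp add: mult_le_0_iff)
    then have "\<forall>i\<in>{..<n}. (cmod (v $ i))\<^sup>2 = 0"
      by (metis (no_types, lifting) finite_lessThan order_antisym sum_nonneg sum_nonneg_eq_0_iff zero_le_power2)
    then have "v = 0\<^sub>v n" using v(1) by (intro eq_vecI) auto
    with v(2) show False by simp
  qed
  then have "pencil \<in> Units (ring_mat TYPE(complex) n ())"
    by (rule det_non_zero_imp_unit[OF pencil_carrier])
  then obtain B where B: "mat_inverse pencil = Some B"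
    using mat_inverse(1)[OF pencil_carrier, where b = "()"] by (cases "mat_inverse pencil") auto
  have "R = B" using B unfolding resolvent_def pencil_def by simp
  with mat_inverse(2)[OF pencil_carrier B]
  show "R \<in> carrier_mat n n" "pencil * R = 1\<^sub>m n" "R * pencil = 1\<^sub>m n" by auto
qed

lemma dim_R [simp]: "dim_row R = n" "dim_col R = n"
  using R_carrier unfolding carrier_mat_def by auto

lemma pencil_R_vec: "v \<in> carrier_vec n \<Longrightarrow> pencil *\<^sub>v (R *\<^sub>v v) = v"
  using assoc_mult_mat_vec[OF pencil_carrier R_carrier, of v] by (simp add: pencil_R)

lemma R_pencil_vec: "v \<in> carrier_vec n \<Longrightarrow> R *\<^sub>v (pencil *\<^sub>v v) = v"
  using assoc_mult_mat_vec[OF R_carrier pencil_carrier, of v] by (simp add: R_pencil)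

lemma R_mult_vec_carrier [simp]: "v \<in> carrier_vec n \<Longrightarrow> R *\<^sub>v v \<in> carrier_vec n"
  by (rule mult_mat_vec_carrier[OF R_carrier])

lemma pencil_transpose: "pencil\<^sup>T = pencil"
  using pencil_carrier unfolding carrier_mat_def
  by (intro eq_matI) (auto simp: pencil_def empirical_cov_index mult.commute)

text \<open>Symmetry is meant for the plain transpose: with z not real, R is not Hermitian.
  Transposing \<open>pencil_R\<close> shows that the transpose is a left inverse too.\<close>

lemma R_symmetric: "R\<^sup>T = R"
proof -
  have "R\<^sup>T * pencil = 1\<^sub>m n"
    using transpose_mult[OF pencil_carrier R_carrier] by (simp add: pencil_R pencil_transpose)
  then have "R\<^sup>T * (pencil * R) = R"
    using assoc_mult_mat[of "R\<^sup>T" n n pencil n R n] by simp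
  then show ?thesis by (simp add: pencil_R)
qed

lemma R_sym_index: "i < n \<Longrightarrow> j < n \<Longrightarrow> R $$ (i, j) = R $$ (j, i)"
  using R_symmetric by (metis dim_R index_transpose_mat(1))

lemma R_mult_vec_index: "v \<in> carrier_vec n \<Longrightarrow> i < n \<Longrightarrow> (R *\<^sub>v v) $ i = (\<Sum>j<n. R $$ (i, j) * v $ j)"
  by (auto simp: scalar_prod_def lessThan_atLeast0 intro!: sum.cong)

lemma R_col_bound:
  assumes j: "j < n"
  shows "(\<Sum>i<n. (cmod (R $$ (i, j)))\<^sup>2) \<le> 1 / (Im z)\<^sup>2"
proof -
  have "(Im z)\<^sup>2 * (\<Sum>i<n. (cmod ((R *\<^sub>v unit_vec n j) $ i))\<^sup>2) \<le> (\<Sum>i<n. (cmod (unit_vec n j $ i))\<^sup>2)"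
    using pencil_norm_bound[of "R *\<^sub>v unit_vec n j"] by (simp add: pencil_R_vec)
  also have "(\<Sum>i<n. (cmod (unit_vec n j $ i))\<^sup>2) = (\<Sum>i<n. if i = j then 1 else 0)"
    using j by (intro sum.cong) auto
  also have "\<dots> = 1" using j by simp
  also have "(\<Sum>i<n. (cmod ((R *\<^sub>v unit_vec n j) $ i))\<^sup>2) = (\<Sum>i<n. (cmod (R $$ (i, j)))\<^sup>2)"
    using j by simp
  finally show ?thesis using z by (simp add: field_simps)
qed

lemma R_frobenius: "(\<Sum>i<n. \<Sum>j<n. (cmod (R $$ (i, j)))\<^sup>2) \<le> n / (Im z)\<^sup>2"
proof -
  have "(\<Sum>j<n. \<Sum>i<n. (cmod (R $$ (i, j)))\<^sup>2) \<le> (\<Sum>j<n. 1 / (Im z)\<^sup>2)"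
    by (intro sum_mono R_col_bound) auto
  then show ?thesis by (subst sum.swap) simp
qed

text \<open>Conjugating \<open>pencil_form\<close> gives x'w = cnj z * s - p with real s, p \<ge> 0,
  because x is real. Multiplication by z turns the first term into the real number |z|^2 s, so that
  the imaginary part now shows p instead of s.\<close>

lemma
  fixes x :: "nat \<Rightarrow> real"
  defines "w \<equiv> R *\<^sub>v vec n (\<lambda>i. of_real (x i))"
  shows Im_real_form: "Im (\<Sum>i<n. of_real (x i) * w $ i) = - (Im z * (\<Sum>i<n. (cmod (w $ i))\<^sup>2))"
    and Im_z_real_form: "Im (z * (\<Sum>i<n. of_real (x i) * w $ i)) = - (Im z * ((\<Sum>t<T. (cmod (proj t w))\<^sup>2) / T))"
proof -
  define s p where "s = (\<Sum>i<n. (cmod (w $ i))\<^sup>2)" and "p = (\<Sum>t<T. (cmod (proj t w))\<^sup>2) / T"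
  have w: "w \<in> carrier_vec n" unfolding w_def by simp
  have "pencil *\<^sub>v w = vec n (\<lambda>i. of_real (x i))" unfolding w_def by (rule pencil_R_vec) simp
  then have "(\<Sum>i<n. of_real (x i) * cnj (w $ i)) = z * of_real s - of_real p"
    using pencil_form[OF w] by (simp add: s_def p_def)
  from arg_cong[OF this, of cnj] have *: "(\<Sum>i<n. of_real (x i) * w $ i) = cnj z * of_real s - of_real p"
    by simp
  show "Im (\<Sum>i<n. of_real (x i) * w $ i) = - (Im z * s)" unfolding * by simp
  show "Im (z * (\<Sum>i<n. of_real (x i) * w $ i)) = - (Im z * p)" unfolding * by (simp add: algebra_simps)
qed

section \<open>Removing one column: the rank-one update\<close>

lemma zero_col_sample: "resolvent_sample n T (zero_col X t) z"
  using X T z by unfold_locales (auto simp: zero_col_def)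

lemma zero_col_index: "i < n \<Longrightarrow> s < T \<Longrightarrow> zero_col X t $$ (i, s) = (if s = t then 0 else X $$ (i, s))"
  by (simp add: zero_col_def)

abbreviation H :: "nat \<Rightarrow> complex mat" where
  "H t \<equiv> resolvent (empirical_cov T (zero_col X t)) z"

definition h :: "nat \<Rightarrow> complex vec" where
  "h t = H t *\<^sub>v vec n (\<lambda>i. of_real (X $$ (i, t)))"

definition a :: "nat \<Rightarrow> complex" where
  "a t = (\<Sum>i<n. of_real (X $$ (i, t)) * h t $ i) / T"

lemma h_carrier [simp]: "h t \<in> carrier_vec n"
  unfolding h_def by (rule resolvent_sample.R_mult_vec_carrier[OF zero_col_sample]) simp

text \<open>\<open>Im_z_real_form\<close> for the reduced matrix gives Im (z (1 - a)) = Im z (1 + p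
  / T) with p \<ge> 0. The bound is kept in product form because \<open>one_minus_a_nonzero\<close>
  is read off from it.\<close>

lemma one_minus_a_bound: "\<bar>Im z\<bar> \<le> cmod z * cmod (1 - a t)"
proof -
  define p where "p = (\<Sum>s<T. (cmod (resolvent_sample.proj n (zero_col X t) s (h t)))\<^sup>2) / T"
  have p: "p \<ge> 0" unfolding p_def by (simp add: sum_nonneg)
  define u where "u = (\<Sum>i<n. of_real (X $$ (i, t)) * h t $ i)"
  have "Im (z * u) = - (Im z * p)"
    unfolding u_def h_def p_def by (rule resolvent_sample.Im_z_real_form[OF zero_col_sample])
  moreover have "Im (z * a t) = Im (z * u) / T"
    unfolding a_def u_def times_divide_eq_right by (rule Im_divide_of_nat)
  ultimately have "Im (z * a t) = - (Im z * p) / T"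
    by simp
  moreover have "Im (z * (1 - a t)) = Im z - Im (z * a t)"
    by (simp add: right_diff_distrib)
  ultimately have "Im (z * (1 - a t)) = Im z * (1 + p / T)"
    by (simp add: distrib_left)
  then have "\<bar>Im (z * (1 - a t))\<bar> = \<bar>Im z\<bar> * (1 + p / T)"
    using p by (simp add: abs_mult)
  moreover have "\<bar>Im z\<bar> * 1 \<le> \<bar>Im z\<bar> * (1 + p / T)"
    using p by (intro mult_left_mono) auto
  ultimately show ?thesis
    using abs_Im_le_cmod[of "z * (1 - a t)"] by (simp add: norm_mult)
qed

lemma one_minus_a_nonzero: "a t \<noteq> 1"
  using one_minus_a_bound[of t] z by auto

text \<open>\<open>Im_real_form\<close> expresses |h|^2 through Im a. The bound by |1 - a| is what
  later cancels the denominator in \<open>R_minus_H\<close>, whatever the size of the removed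
  column.\<close>

lemma h_norm_bound: "\<bar>Im z\<bar> * (\<Sum>i<n. (cmod (h t $ i))\<^sup>2) \<le> T * cmod (1 - a t)"
proof -
  define s u where "s = (\<Sum>i<n. (cmod (h t $ i))\<^sup>2)" and "u = (\<Sum>i<n. of_real (X $$ (i, t)) * h t $ i)"
  have s: "s \<ge> 0" unfolding s_def by (intro sum_nonneg) auto
  have "Im u = - (Im z * s)"
    unfolding u_def h_def s_def by (rule resolvent_sample.Im_real_form[OF zero_col_sample])
  moreover have "Im (a t) = Im u / T"
    unfolding a_def u_def by (rule Im_divide_of_nat)
  ultimately have "T * Im (1 - a t) = Im z * s"
    using T by simp
  then have "\<bar>Im z\<bar> * s = T * \<bar>Im (1 - a t)\<bar>"
    using s by (metis abs_mult abs_of_nat abs_of_nonneg)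
  also have "\<dots> \<le> T * cmod (1 - a t)"
    by (intro mult_left_mono abs_Im_le_cmod) simp
  finally show ?thesis by (simp add: s_def)
qed

text \<open>E exceeds the reduced covariance by x x' / T. Stating the update as an action on vectors
  avoids forming the outer product.\<close>

lemma pencil_zero_col:
  assumes t: "t < T" and v: "v \<in> carrier_vec n"
  shows "pencil *\<^sub>v v = resolvent_sample.pencil n T (zero_col X t) z *\<^sub>v v
     + (- proj t v / T) \<cdot>\<^sub>v vec n (\<lambda>i. of_real (X $$ (i, t)))"
proof -
  interpret Y: resolvent_sample n T "zero_col X t" z by (rule zero_col_sample)
  have proj: "Y.proj s v = (if s = t then 0 else proj s v)" if "s < T" for s
    using that unfolding Y.proj_def proj_def by (simp add: zero_col_index)
  have "(pencil *\<^sub>v v) $ i = (Y.pencil *\<^sub>v v + (- proj t v / T) \<cdot>\<^sub>v vec n (\<lambda>i. of_real (X $$ (i, t)))) $ i"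
    if i: "i < n" for i
  proof -
    have "(\<Sum>s<T. of_real (X $$ (i, s)) * proj s v)
        = of_real (X $$ (i, t)) * proj t v + (\<Sum>s\<in>{..<T} - {t}. of_real (X $$ (i, s)) * proj s v)"
      using t by (intro sum.remove) auto
    also have "(\<Sum>s\<in>{..<T} - {t}. of_real (X $$ (i, s)) * proj s v)
        = (\<Sum>s<T. of_real (zero_col X t $$ (i, s)) * Y.proj s v)"
      using t i by (intro sum.mono_neutral_cong_left) (auto simp: proj zero_col_index)
    finally have "(\<Sum>s<T. of_real (X $$ (i, s)) * proj s v)
       = of_real (X $$ (i, t)) * proj t v + (\<Sum>s<T. of_real (zero_col X t $$ (i, s)) * Y.proj s v)" .
    moreover have "(Y.pencil *\<^sub>v v + (- proj t v / T) \<cdot>\<^sub>v vec n (\<lambda>i. of_real (X $$ (i, t)))) $ i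
        = (Y.pencil *\<^sub>v v) $ i + (- proj t v / T) * of_real (X $$ (i, t))"
      using i Y.pencil_carrier v by (subst index_add_vec) (auto simp del: index_mult_mat_vec)
    ultimately show ?thesis
      unfolding pencil_mult_vec[OF v i] Y.pencil_mult_vec[OF v i] by (simp add: add_divide_distrib)
  qed
  then show ?thesis
    by (intro eq_vecI) (auto simp: dim_pencil simp del: index_mult_mat_vec)
qed

text \<open>By \<open>pencil_zero_col\<close>, z - E sends h to x - a x, a multiple of x itself, so
  inverting only costs the scalar 1 - a.\<close>

lemma R_col_vec:
  assumes t: "t < T"
  shows "R *\<^sub>v vec n (\<lambda>i. of_real (X $$ (i, t))) = (1 / (1 - a t)) \<cdot>\<^sub>v h t"
proof -
  interpret Y: resolvent_sample n T "zero_col X t" z by (rule zero_col_sample)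
  let ?x = "vec n (\<lambda>i. complex_of_real (X $$ (i, t)))"
  have "Y.pencil *\<^sub>v h t = ?x"
    unfolding h_def by (rule Y.pencil_R_vec) simp
  then have "pencil *\<^sub>v h t = ?x + (- proj t (h t) / T) \<cdot>\<^sub>v ?x"
    unfolding pencil_zero_col[OF t h_carrier] by simp
  also have "- proj t (h t) / T = - a t"
    by (simp add: a_def proj_def)
  finally have "pencil *\<^sub>v h t = ?x + (- a t) \<cdot>\<^sub>v ?x" .
  also have "?x + (- a t) \<cdot>\<^sub>v ?x = (1 - a t) \<cdot>\<^sub>v ?x"
    by (intro eq_vecI) (auto simp: algebra_simps)
  finally have "pencil *\<^sub>v h t = (1 - a t) \<cdot>\<^sub>v ?x" .
  then have "pencil *\<^sub>v ((1 / (1 - a t)) \<cdot>\<^sub>v h t) = ?x"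
    using one_minus_a_nonzero[of t] mult_mat_vec[OF pencil_carrier h_carrier, of "1 / (1 - a t)" t]
    by (simp add: smult_smult_assoc)
  then show ?thesis
    using R_pencil_vec[of "(1 / (1 - a t)) \<cdot>\<^sub>v h t"] by simp
qed

text \<open>The Sherman-Morrison formula, found by applying z - E to a column of \<open>H t\<close>:
  this gives a unit vector plus a multiple of x, and \<open>R_col_vec\<close> says what R does to
  x.\<close>

lemma R_minus_H:
  assumes t: "t < T" and i: "i < n" and j: "j < n"
  shows "R $$ (i, j) - H t $$ (i, j) = h t $ i * h t $ j / (T * (1 - a t))"
proof -
  interpret Y: resolvent_sample n T "zero_col X t" z by (rule zero_col_sample)
  let ?x = "vec n (\<lambda>i. complex_of_real (X $$ (i, t)))"
  define c where "c = col (H t) j"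
  have c: "c \<in> carrier_vec n" unfolding c_def by (intro carrier_vecI) simp
  have cH: "c = H t *\<^sub>v unit_vec n j"
    unfolding c_def using j by (intro eq_vecI) auto
  \<comment> \<open>The symmetry of \<open>H t\<close> turns x' times its column j into entry j of
    \<open>h t\<close>.\<close>
  have proj: "proj t c = h t $ j"
    using j Y.R_sym_index by (auto simp: proj_def c_def h_def Y.R_mult_vec_index mult.commute simp del: index_mult_mat_vec intro!: sum.cong)
  have "Y.pencil *\<^sub>v c = unit_vec n j"
    unfolding cH by (rule Y.pencil_R_vec) simp
  then have "pencil *\<^sub>v c = unit_vec n j + (- h t $ j / T) \<cdot>\<^sub>v ?x"
    unfolding pencil_zero_col[OF t c] proj by simp
  then have "c = R *\<^sub>v (unit_vec n j + (- h t $ j / T) \<cdot>\<^sub>v ?x)"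
    using R_pencil_vec[OF c] by simp
  also have "\<dots> = R *\<^sub>v unit_vec n j + (- h t $ j / T) \<cdot>\<^sub>v ((1 / (1 - a t)) \<cdot>\<^sub>v h t)"
    by (subst mult_add_distrib_mat_vec[OF R_carrier]) (auto simp: mult_mat_vec[OF R_carrier] R_col_vec[OF t])
  finally have "c $ i = (R *\<^sub>v unit_vec n j + (- h t $ j / T) \<cdot>\<^sub>v ((1 / (1 - a t)) \<cdot>\<^sub>v h t)) $ i"
    by simp
  also have "\<dots> = R $$ (i, j) - h t $ j / T * (1 / (1 - a t) * h t $ i)"
    using i j by (simp add: carrier_vecD[OF h_carrier])
  finally show ?thesis
    using i j by (simp add: c_def algebra_simps)
qed

text \<open>The diagonal of z R = 1 + E R, with E split over the sample columns; symmetry of R turns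
  x'R into R x.\<close>

lemma pencil_R_diag:
  assumes i: "i < n"
  shows "z * R $$ (i, i) = 1 + (\<Sum>t<T. of_real (X $$ (i, t)) * (R *\<^sub>v vec n (\<lambda>k. of_real (X $$ (k, t)))) $ i) / T"
proof -
  have c: "col R i \<in> carrier_vec n" by (intro carrier_vecI) simp
  have cR: "col R i = R *\<^sub>v unit_vec n i"
    using i by (intro eq_vecI) auto
  have "(pencil *\<^sub>v col R i) $ i = 1"
    unfolding cR using i by (simp add: pencil_R_vec del: index_mult_mat_vec)
  moreover have "proj t (col R i) = (R *\<^sub>v vec n (\<lambda>k. of_real (X $$ (k, t)))) $ i" for t
    using i R_sym_index by (auto simp: proj_def R_mult_vec_index mult.commute simp del: index_mult_mat_vec intro!: sum.cong)
  ultimately show ?thesis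
    using pencil_mult_vec[OF c i] i by (simp add: algebra_simps)
qed

section \<open>The trace functionals G and L\<close>

lemma trace_resolvent: "mat_trace R = (\<Sum>i<n. R $$ (i, i))"
  by (simp add: mat_trace_def)

text \<open>Summing the diagonal gives z Tr R = n + \<Sum> x'R x / T, and each x'R x / T equals a /
  (1 - a) = 1 / (1 - a) - 1. The T copies of -1, together with n, account for 1 - q.\<close>

lemma G_fun_leave_one_out:
  "1 - of_real (real n / T) + z * G_fun T X z = (\<Sum>t<T. 1 / (1 - a t)) / T"
proof -
  have "z * mat_trace R = (\<Sum>i<n. z * R $$ (i, i))"
    by (simp add: trace_resolvent sum_distrib_left)
  also have "\<dots> = (\<Sum>i<n. 1 + (\<Sum>t<T. of_real (X $$ (i, t)) * (R *\<^sub>v vec n (\<lambda>k. of_real (X $$ (k, t)))) $ i) / T)"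
    by (intro sum.cong refl pencil_R_diag) auto
  also have "\<dots> = n + (\<Sum>i<n. \<Sum>t<T. of_real (X $$ (i, t)) * (R *\<^sub>v vec n (\<lambda>k. of_real (X $$ (k, t)))) $ i) / T"
    by (simp add: sum.distrib sum_divide_distrib del: index_mult_mat_vec)
  also have "(\<Sum>i<n. \<Sum>t<T. of_real (X $$ (i, t)) * (R *\<^sub>v vec n (\<lambda>k. of_real (X $$ (k, t)))) $ i)
      = (\<Sum>t<T. \<Sum>i<n. of_real (X $$ (i, t)) * (h t $ i / (1 - a t)))"
    by (subst sum.swap) (auto intro!: sum.cong simp: R_col_vec carrier_vecD[OF h_carrier] simp del: index_mult_mat_vec)
  also have "\<dots> = (\<Sum>t<T. T * (1 / (1 - a t) - 1))"
  proof (intro sum.cong refl)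
    fix t
    have "(\<Sum>i<n. of_real (X $$ (i, t)) * (h t $ i / (1 - a t))) = T * a t / (1 - a t)"
    proof -
      have "T * a t = (\<Sum>i<n. of_real (X $$ (i, t)) * h t $ i)"
        using T by (simp add: a_def)
      then show ?thesis by (simp add: sum_divide_distrib)
    qed
    also have "\<dots> = T * (1 / (1 - a t) - 1)"
      using one_minus_a_nonzero[of t] by (simp add: field_simps)
    finally show "(\<Sum>i<n. of_real (X $$ (i, t)) * (h t $ i / (1 - a t))) = T * (1 / (1 - a t) - 1)" .
  qed
  also have "\<dots> = T * ((\<Sum>t<T. 1 / (1 - a t)) - T)"
    by (simp add: sum_subtractf flip: sum_distrib_left)
  finally have "z * mat_trace R = n + ((\<Sum>t<T. 1 / (1 - a t)) - T)"
    using T by simp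
  moreover have "z * G_fun T X z = z * mat_trace R / T"
    by (simp add: G_fun_def)
  ultimately show ?thesis
    using T by (simp add: add_divide_distrib diff_divide_distrib)
qed

lemma L_fun_eq:
  assumes S: "S \<in> carrier_mat n n"
  shows "L_fun T S X z = (\<Sum>i<n. \<Sum>j<n. of_real (S $$ (i, j)) * R $$ (j, i)) / T"
proof -
  have "mat_trace (R * map_mat complex_of_real S) = (\<Sum>j<n. \<Sum>i<n. R $$ (j, i) * of_real (S $$ (i, j)))"
    using S by (auto simp: mat_trace_def scalar_prod_def lessThan_atLeast0 intro!: sum.cong)
  also have "\<dots> = (\<Sum>i<n. \<Sum>j<n. of_real (S $$ (i, j)) * R $$ (j, i))"
    by (subst sum.swap) (simp add: mult.commute)
  finally show ?thesis by (simp add: L_fun_def)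
qed

text \<open>The inner sum is entry i of S applied to column i of R, hence at most
  \<open>op_norm S\<close> / |Im z|; there are n of them.\<close>

lemma L_fun_bound:
  assumes S: "S \<in> carrier_mat n n"
  shows "cmod (L_fun T S X z) \<le> op_norm S * n / (\<bar>Im z\<bar> * T)"
proof -
  have row: "cmod (\<Sum>j<n. of_real (S $$ (i, j)) * R $$ (j, i)) \<le> op_norm S / \<bar>Im z\<bar>" if i: "i < n" for i
  proof -
    have "(cmod (\<Sum>j<n. of_real (S $$ (i, j)) * R $$ (j, i)))\<^sup>2
        \<le> (\<Sum>k<n. (cmod (\<Sum>j<n. of_real (S $$ (k, j)) * R $$ (j, i)))\<^sup>2)"
      using i by (intro member_le_sum) auto
    also have "\<dots> \<le> (op_norm S)\<^sup>2 * (\<Sum>j<n. (cmod (R $$ (j, i)))\<^sup>2)"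
      by (rule op_norm_complex_bound[OF S])
    also have "\<dots> \<le> (op_norm S)\<^sup>2 * (1 / (Im z)\<^sup>2)"
      by (intro mult_left_mono R_col_bound i) simp
    also have "\<dots> = (op_norm S / \<bar>Im z\<bar>)\<^sup>2"
      by (simp add: power_divide)
    finally show ?thesis
      by (rule power2_le_imp_le) (simp add: op_norm_nonneg)
  qed
  have "cmod (\<Sum>i<n. \<Sum>j<n. of_real (S $$ (i, j)) * R $$ (j, i)) \<le> (\<Sum>i<n. op_norm S / \<bar>Im z\<bar>)"
    by (intro order_trans[OF norm_sum] sum_mono row) simp
  then have "cmod (\<Sum>i<n. \<Sum>j<n. of_real (S $$ (i, j)) * R $$ (j, i)) / T \<le> (n * (op_norm S / \<bar>Im z\<bar>)) / T"
    by (intro divide_right_mono) auto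
  then show ?thesis
    unfolding L_fun_eq[OF S] by (simp add: norm_divide mult.commute)
qed

text \<open>By \<open>R_minus_H\<close> the difference is h'S h / (T^2 (1 - a)). Its numerator is at
  most \<open>op_norm S\<close> |h|^2, and \<open>h_norm_bound\<close> trades |h|^2 for T |1 - a|,
  so the denominator cancels.\<close>

lemma L_fun_zero_col:
  assumes S: "S \<in> carrier_mat n n" and t: "t < T"
  shows "cmod (L_fun T S X z - L_fun T S (zero_col X t) z) \<le> op_norm S / (\<bar>Im z\<bar> * T)"
proof -
  interpret Y: resolvent_sample n T "zero_col X t" z by (rule zero_col_sample)
  define F where "F = (\<Sum>i<n. (cmod (h t $ i))\<^sup>2)"
  define Q where "Q = (\<Sum>i<n. h t $ i * (\<Sum>j<n. of_real (S $$ (i, j)) * h t $ j))"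
  have F0: "F \<ge> 0" unfolding F_def by (intro sum_nonneg) auto
  have "(cmod Q)\<^sup>2 \<le> (\<Sum>i<n. cmod (h t $ i) * cmod (\<Sum>j<n. of_real (S $$ (i, j)) * h t $ j))\<^sup>2"
    unfolding Q_def by (intro power_mono order_trans[OF norm_sum]) (simp_all add: norm_mult)
  also have "\<dots> \<le> F * (\<Sum>i<n. (cmod (\<Sum>j<n. of_real (S $$ (i, j)) * h t $ j))\<^sup>2)"
    unfolding F_def by (rule Cauchy_Schwarz_ineq_sum)
  also have "\<dots> \<le> F * ((op_norm S)\<^sup>2 * F)"
    unfolding F_def by (intro mult_left_mono op_norm_complex_bound[OF S] sum_nonneg) auto
  also have "\<dots> = (op_norm S * F)\<^sup>2" by (simp add: power2_eq_square)
  finally have Q: "cmod Q \<le> op_norm S * F"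
    by (rule power2_le_imp_le) (simp add: F0 op_norm_nonneg)
  have "L_fun T S X z - L_fun T S (zero_col X t) z
      = (\<Sum>i<n. \<Sum>j<n. of_real (S $$ (i, j)) * (R $$ (j, i) - Y.R $$ (j, i))) / T"
    unfolding L_fun_eq[OF S] Y.L_fun_eq[OF S] by (simp add: right_diff_distrib sum_subtractf diff_divide_distrib)
  also have "\<dots> = (\<Sum>i<n. \<Sum>j<n. of_real (S $$ (i, j)) * (h t $ j * h t $ i / (T * (1 - a t)))) / T"
    using R_minus_H[OF t] by simp
  also have "\<dots> = Q / (T * (1 - a t)) / T"
    unfolding Q_def sum_distrib_left sum_divide_distrib[of _ _ "T * (1 - a t)"]
    by (intro sum.cong refl arg_cong2[where f = "(/)"]) (simp add: mult_ac)
  finally have "cmod (L_fun T S X z - L_fun T S (zero_col X t) z) = cmod Q / (T * cmod (1 - a t)) / T"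
    by (simp add: norm_divide norm_mult)
  also have "\<dots> \<le> op_norm S / \<bar>Im z\<bar> / T"
  proof (intro divide_right_mono)
    have pos: "T * cmod (1 - a t) > 0"
      using T one_minus_a_nonzero[of t] by simp
    have "\<bar>Im z\<bar> * cmod Q \<le> op_norm S * (\<bar>Im z\<bar> * F)"
      using mult_left_mono[OF Q, of "\<bar>Im z\<bar>"] by (simp add: mult_ac)
    also have "\<dots> \<le> op_norm S * (T * cmod (1 - a t))"
      unfolding F_def by (intro mult_left_mono h_norm_bound op_norm_nonneg)
    finally show "cmod Q / (T * cmod (1 - a t)) \<le> op_norm S / \<bar>Im z\<bar>"
      using pos z by (simp add: divide_simps mult_ac)
  qed simp
  finally show ?thesis by simp
qed

text \<open>Termwise, (1 - L) / (1 - a) - 1 = (a - L) / (1 - a). Here L is replaced by the L of the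
  matrix without column t, the centering that suits a coefficient matrix independent of that column;
  the price is the \<open>op_norm\<close> term.\<close>

lemma deterministic_equivalent:
  assumes S: "S \<in> carrier_mat n n"
  shows "cmod ((1 - of_real (real n / T) + z * G_fun T X z) * (1 - L_fun T S X z) - 1)
    \<le> cmod z / \<bar>Im z\<bar> * ((\<Sum>t<T. cmod (a t - L_fun T S (zero_col X t) z)) / T + op_norm S / (\<bar>Im z\<bar> * T))"
proof -
  define \<rho> where "\<rho> = cmod z / \<bar>Im z\<bar>"
  define L where "L = L_fun T S X z"
  define d where "d t = cmod (a t - L_fun T S (zero_col X t) z)" for t
  have \<rho>0: "\<rho> \<ge> 0" by (simp add: \<rho>_def)
  have inv: "1 / cmod (1 - a t) \<le> \<rho>" for t
    using one_minus_a_bound[of t] one_minus_a_nonzero[of t] z by (simp add: \<rho>_def divide_simps mult.commute)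
  have "((\<Sum>t<T. 1 / (1 - a t)) / T) * (1 - L) - 1 = (\<Sum>t<T. (1 - L) / (1 - a t) - 1) / T"
    using T by (simp add: sum_subtractf sum_distrib_right diff_divide_distrib)
  also have "(\<Sum>t<T. (1 - L) / (1 - a t) - 1) = (\<Sum>t<T. (a t - L) / (1 - a t))"
    using one_minus_a_nonzero by (intro sum.cong refl) (simp add: field_simps)
  finally have "cmod (((\<Sum>t<T. 1 / (1 - a t)) / T) * (1 - L) - 1) = cmod (\<Sum>t<T. (a t - L) / (1 - a t)) / T"
    by (simp add: norm_divide)
  also have "\<dots> \<le> (\<Sum>t<T. \<rho> * (d t + op_norm S / (\<bar>Im z\<bar> * T))) / T"
  proof (intro divide_right_mono order_trans[OF norm_sum] sum_mono)
    fix t assume t: "t \<in> {..<T}"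
    have "cmod (a t - L) \<le> d t + op_norm S / (\<bar>Im z\<bar> * T)"
      using norm_triangle_ineq4[of "a t - L_fun T S (zero_col X t) z" "L - L_fun T S (zero_col X t) z"]
        L_fun_zero_col[OF S, of t] t by (simp add: d_def L_def)
    then have "(1 / cmod (1 - a t)) * cmod (a t - L) \<le> \<rho> * (d t + op_norm S / (\<bar>Im z\<bar> * T))"
      using inv[of t] \<rho>0 by (intro mult_mono) auto
    then show "cmod ((a t - L) / (1 - a t)) \<le> \<rho> * (d t + op_norm S / (\<bar>Im z\<bar> * T))"
      by (simp add: norm_divide)
  qed simp
  also have "\<dots> = \<rho> * ((\<Sum>t<T. d t) / T + op_norm S / (\<bar>Im z\<bar> * T))"
    using T unfolding sum_distrib_left[symmetric] by (simp add: sum.distrib add_divide_distrib distrib_left)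
  finally show ?thesis
    unfolding G_fun_leave_one_out \<rho>_def d_def L_def .
qed

text \<open>Both terms are bilinear pairings with the same matrix \<open>H t\<close>, so only x x' -
  S remains, with coefficients that do not involve column t.\<close>

lemma a_minus_L_fun:
  assumes S: "S \<in> carrier_mat n n"
  shows "a t - L_fun T S (zero_col X t) z
    = (\<Sum>i<n. \<Sum>j<n. of_real (X $$ (i, t) * X $$ (j, t) - S $$ (i, j)) * H t $$ (i, j)) / T"
proof -
  interpret Y: resolvent_sample n T "zero_col X t" z by (rule zero_col_sample)
  have "a t = (\<Sum>i<n. \<Sum>j<n. of_real (X $$ (i, t) * X $$ (j, t)) * Y.R $$ (i, j)) / T"
    unfolding a_def h_def by (auto simp: Y.R_mult_vec_index sum_distrib_left mult_ac simp del: index_mult_mat_vec intro!: sum.cong)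
  moreover have "L_fun T S (zero_col X t) z = (\<Sum>i<n. \<Sum>j<n. of_real (S $$ (i, j)) * Y.R $$ (i, j)) / T"
    unfolding Y.L_fun_eq[OF S] by (auto intro!: sum.cong simp: Y.R_sym_index)
  ultimately show ?thesis
    by (simp add: left_diff_distrib sum_subtractf diff_divide_distrib)
qed

lemma R_entry_bound:
  assumes "i < n" "j < n"
  shows "cmod (R $$ (i, j)) \<le> 1 / \<bar>Im z\<bar>"
proof -
  have "(cmod (R $$ (i, j)))\<^sup>2 \<le> (\<Sum>k<n. (cmod (R $$ (k, j)))\<^sup>2)"
    using assms by (intro member_le_sum) auto
  also have "\<dots> \<le> (1 / \<bar>Im z\<bar>)\<^sup>2"
    using R_col_bound[OF assms(2)] by (simp add: power_divide)
  finally show ?thesis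
    by (rule power2_le_imp_le) simp
qed

end

text \<open>No lower bound on |D| is assumed: from |D (1 - L)| \<ge> 1/2 one gets 1 / |D| \<le> 2 |1
  - L|, so a bound on L takes its place.\<close>

lemma inverse_perturbation:
  fixes D L :: complex
  assumes "cmod (D * (1 - L) - 1) \<le> \<eta>" "\<eta> \<le> 1 / 2"
  shows "cmod (L - (1 - 1 / D)) \<le> 2 * \<eta> * (1 + cmod L)"
proof -
  \<comment> \<open>For D = 0 the first assumption would read 1 \<le> \<eta>.\<close>
  have D: "D \<noteq> 0" using assms by auto
  have "1 \<le> cmod (D * (1 - L)) + cmod (D * (1 - L) - 1)"
    using norm_triangle_ineq4[of "D * (1 - L)" "D * (1 - L) - 1"] by simp
  then have "1 / 2 \<le> cmod D * cmod (1 - L)"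
    using assms by (simp add: norm_mult)
  then have inv: "1 / cmod D \<le> 2 * cmod (1 - L)"
    using D by (simp add: field_simps)
  have "L - (1 - 1 / D) = - (D * (1 - L) - 1) / D"
    using D by (simp add: field_simps)
  then have "cmod (L - (1 - 1 / D)) = cmod (D * (1 - L) - 1) * (1 / cmod D)"
    by (simp add: norm_divide norm_minus_commute)
  also have "\<dots> \<le> \<eta> * (2 * cmod (1 - L))"
    using assms inv by (intro mult_mono) (auto intro: order_trans[OF norm_ge_zero])
  also have "\<dots> \<le> \<eta> * (2 * (1 + cmod L))"
    using norm_triangle_ineq4[of 1 L] assms(1) order_trans[OF norm_ge_zero assms(1)]
    by (intro mult_left_mono) auto
  finally show ?thesis by (simp add: algebra_simps)
qed

subsection \<open>Measurability of the resolvent\<close>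

lemma borel_measurable_cnj: "f \<in> borel_measurable M \<Longrightarrow> (\<lambda>\<omega>. cnj (f \<omega>)) \<in> borel_measurable M"
  by (rule measurable_compose[where g = cnj, OF _ borel_measurable_continuous_onI]) (auto intro: continuous_intros)

lemma borel_measurable_det:
  fixes A :: "'w \<Rightarrow> complex mat"
  assumes A: "\<And>\<omega>. \<omega> \<in> space M \<Longrightarrow> A \<omega> \<in> carrier_mat k k"
    and meas: "\<And>i j. i < k \<Longrightarrow> j < k \<Longrightarrow> (\<lambda>\<omega>. A \<omega> $$ (i, j)) \<in> borel_measurable M"
  shows "(\<lambda>\<omega>. det (A \<omega>)) \<in> borel_measurable M"
proof -
  have "(\<lambda>\<omega>. \<Sum>p | p permutes {0..<k}. signof p * (\<Prod>i = 0..<k. A \<omega> $$ (i, p i))) \<in> borel_measurable M"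
    by (intro borel_measurable_sum borel_measurable_times borel_measurable_prod meas borel_measurable_const)
      (auto simp: permutes_in_image)
  then show ?thesis
    by (rule measurable_cong[THEN iffD1, rotated]) (simp add: det_def'[OF A])
qed

text \<open>\<open>mat_inverse\<close> runs an elimination with data-dependent branches, so
  measurability is obtained from Cramer's rule: a cofactor divided by the determinant, both
  polynomial in the entries. The measure is arbitrary because the lemma is applied to the
  probability space and to a product space of columns.\<close>

lemma borel_measurable_resolvent:
  assumes T: "T > 0" and z: "Im z \<noteq> 0"
    and Y: "\<And>\<omega>. \<omega> \<in> space M \<Longrightarrow> Y \<omega> \<in> carrier_mat n T"
    and meas: "\<And>i t. i < n \<Longrightarrow> t < T \<Longrightarrow> (\<lambda>\<omega>. Y \<omega> $$ (i, t)) \<in> borel_measurable M"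
    and ij: "i < n" "j < n"
  shows "(\<lambda>\<omega>. resolvent (empirical_cov T (Y \<omega>)) z $$ (i, j)) \<in> borel_measurable M"
proof -
  let ?P = "\<lambda>\<omega>. resolvent_sample.pencil n T (Y \<omega>) z"
  have sample: "resolvent_sample n T (Y \<omega>) z" if "\<omega> \<in> space M" for \<omega>
    using T z Y[OF that] by unfold_locales
  have carrier: "?P \<omega> \<in> carrier_mat n n" if "\<omega> \<in> space M" for \<omega>
    by (rule resolvent_sample.pencil_carrier[OF sample[OF that]])
  have entry: "(\<lambda>\<omega>. ?P \<omega> $$ (k, l)) \<in> borel_measurable M" if kl: "k < n" "l < n" for k l
  proof -
    have "(\<lambda>\<omega>. (\<Sum>t<T. Y \<omega> $$ (k, t) * Y \<omega> $$ (l, t)) / T) \<in> borel_measurable M"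
      using kl by (intro borel_measurable_divide borel_measurable_const borel_measurable_sum borel_measurable_times meas) auto
    then have "(\<lambda>\<omega>. (if k = l then z else 0) - of_real ((\<Sum>t<T. Y \<omega> $$ (k, t) * Y \<omega> $$ (l, t)) / T)) \<in> borel_measurable M"
      by (intro borel_measurable_diff borel_measurable_const measurable_compose[OF _ borel_measurable_of_real])
    then show ?thesis
    proof (rule measurable_cong[THEN iffD1, rotated])
      fix \<omega> assume \<omega>: "\<omega> \<in> space M"
      interpret resolvent_sample n T "Y \<omega>" z by (rule sample[OF \<omega>])
      show "(if k = l then z else 0) - of_real ((\<Sum>t<T. Y \<omega> $$ (k, t) * Y \<omega> $$ (l, t)) / T) = ?P \<omega> $$ (k, l)"
        using kl by (simp add: pencil_def empirical_cov_index)
    qed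
  qed
  have det: "(\<lambda>\<omega>. det (?P \<omega>)) \<in> borel_measurable M"
    by (intro borel_measurable_det[of _ _ n] carrier entry)
  have del: "(\<lambda>\<omega>. det (mat_delete (?P \<omega>) j i)) \<in> borel_measurable M"
  proof (rule borel_measurable_det)
    show "mat_delete (?P \<omega>) j i \<in> carrier_mat (n - 1) (n - 1)" if "\<omega> \<in> space M" for \<omega>
      using carrier[OF that] by (rule mat_delete_carrier)
    fix k l assume kl: "k < n - 1" "l < n - 1"
    \<comment> \<open>Deleting row j and column i shifts the later indices by one.\<close>
    have "(\<lambda>\<omega>. ?P \<omega> $$ (if k < j then k else Suc k, if l < i then l else Suc l)) \<in> borel_measurable M"
      using kl by (intro entry) auto
    then show "(\<lambda>\<omega>. mat_delete (?P \<omega>) j i $$ (k, l)) \<in> borel_measurable M"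
      by (rule measurable_cong[THEN iffD1, rotated]) (use kl carrier in \<open>fastforce simp: mat_delete_def\<close>)
  qed
  have "(\<lambda>\<omega>. (-1) ^ (j + i) * det (mat_delete (?P \<omega>) j i) / det (?P \<omega>)) \<in> borel_measurable M"
    by (intro borel_measurable_divide borel_measurable_times borel_measurable_const det del)
  then show ?thesis
  proof (rule measurable_cong[THEN iffD1, rotated])
    fix \<omega> assume \<omega>: "\<omega> \<in> space M"
    interpret resolvent_sample n T "Y \<omega>" z by (rule sample[OF \<omega>])
    have adj: "adj_mat pencil \<in> carrier_mat n n" "pencil * adj_mat pencil = det pencil \<cdot>\<^sub>m 1\<^sub>m n"
      by (rule adj_mat[OF pencil_carrier])+
    have "det pencil * det R = 1"
      using det_mult[OF pencil_carrier R_carrier] by (simp add: pencil_R)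
    then have nz: "det pencil \<noteq> 0" by (metis mult_zero_left zero_neq_one)
    have "adj_mat pencil = R * (pencil * adj_mat pencil)"
      using assoc_mult_mat[OF R_carrier pencil_carrier adj(1)] adj(1) by (simp add: R_pencil)
    also have "\<dots> = det pencil \<cdot>\<^sub>m R"
      unfolding adj(2) using mult_smult_distrib[OF R_carrier one_carrier_mat] by simp
    finally have "adj_mat pencil $$ (i, j) = det pencil * R $$ (i, j)"
      using ij by simp
    moreover have "adj_mat pencil $$ (i, j) = (-1) ^ (j + i) * det (mat_delete pencil j i)"
      using ij by (simp add: adj_mat_def dim_pencil cofactor_def)
    ultimately show "(-1) ^ (j + i) * det (mat_delete (?P \<omega>) j i) / det (?P \<omega>) = R $$ (i, j)"
      using nz by (simp add: field_simps)
  qed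
qed

subsection \<open>Gaussian moments\<close>

text \<open>Mean zero forces \<mu> = 0. In the degenerate case both sides vanish; otherwise the
  moments are \<sigma>^2 and 3 \<sigma>^4. Writing the result through the second moment covers both
  cases without \<sigma>.\<close>

lemma gaussian_rv_fourth_moment:
  assumes g: "gaussian_rv M Y" and mean: "integral\<^sup>L M Y = 0"
  shows integrable_gaussian_fourth: "integrable M (\<lambda>\<omega>. Y \<omega> ^ 4)"
    and integral_gaussian_fourth: "(\<integral>\<omega>. Y \<omega> ^ 4 \<partial>M) = 3 * (\<integral>\<omega>. (Y \<omega>)\<^sup>2 \<partial>M)\<^sup>2"
proof -
  have Y[measurable]: "Y \<in> borel_measurable M" using g by (simp add: gaussian_rv_def)
  obtain \<mu> \<sigma> where \<sigma>: "\<sigma> \<ge> 0"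
    and D: "distr M borel Y = (if \<sigma> = 0 then return borel \<mu> else density lborel (normal_density \<mu> \<sigma>))"
    using g unfolding gaussian_rv_def by blast
  have "integrable M (\<lambda>\<omega>. Y \<omega> ^ 4) \<and> (\<integral>\<omega>. Y \<omega> ^ 4 \<partial>M) = 3 * (\<integral>\<omega>. (Y \<omega>)\<^sup>2 \<partial>M)\<^sup>2"
  proof (cases "\<sigma> = 0")
    case True
    then have D: "distr M borel Y = return borel \<mu>" using D by simp
    have int: "(\<integral>\<omega>. f (Y \<omega>) \<partial>M) = f \<mu>" if [measurable]: "f \<in> borel_measurable borel" for f :: "real \<Rightarrow> real"
      using integral_distr[OF Y that] integral_return[of \<mu> borel f] by (simp add: D)
    have "\<mu> = 0" using int[of "\<lambda>x. x"] mean by simp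
    have "integrable (return borel \<mu>) (\<lambda>x::real. x ^ 4)"
      by (subst integrable_cong_AE[where g = "\<lambda>_. \<mu> ^ 4"])
        (auto simp: AE_return prob_space.finite_measure prob_space_return intro!: finite_measure.integrable_const)
    then have "integrable M (\<lambda>\<omega>. Y \<omega> ^ 4)"
      using integrable_distr_eq[OF Y, of "\<lambda>x. x ^ 4"] by (simp add: D)
    then show ?thesis
      using int[of "\<lambda>x. x ^ 4"] int[of "\<lambda>x. x\<^sup>2"] \<open>\<mu> = 0\<close> by simp
  next
    case False
    then have pos: "\<sigma> > 0" and D: "distr M borel Y = density lborel (normal_density \<mu> \<sigma>)"
      using \<sigma> D by auto
    have int: "(\<integral>\<omega>. f (Y \<omega>) \<partial>M) = (\<integral>x. normal_density \<mu> \<sigma> x * f x \<partial>lborel)"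
      if [measurable]: "f \<in> borel_measurable borel" for f :: "real \<Rightarrow> real"
      using integral_distr[OF Y that] by (simp add: D integral_density)
    have "\<mu> = 0"
      using int[of "\<lambda>x. x"] mean integral_normal_moment_nz_1[OF pos] by simp
    have "integrable (distr M borel Y) (\<lambda>x. x ^ 4)"
      unfolding D using integrable_normal_moment[OF pos, of \<mu> 4] \<open>\<mu> = 0\<close> by (simp add: integrable_density)
    then have "integrable M (\<lambda>\<omega>. Y \<omega> ^ 4)"
      using integrable_distr_eq[OF Y, of "\<lambda>x. x ^ 4"] by simp
    moreover have "(\<integral>\<omega>. (Y \<omega>)\<^sup>2 \<partial>M) = \<sigma>\<^sup>2"
      using integral_normal_moment_even[OF pos, of \<mu> 1] \<open>\<mu> = 0\<close> pos
      by (subst int) (auto simp: fact_numeral)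
    moreover have "(\<integral>\<omega>. Y \<omega> ^ 4 \<partial>M) = 3 * (\<sigma>\<^sup>2)\<^sup>2"
      using integral_normal_moment_even[OF pos, of \<mu> 2] \<open>\<mu> = 0\<close> pos
      by (subst int) (auto simp: fact_numeral field_simps)
    ultimately show ?thesis by simp
  qed
  then show "integrable M (\<lambda>\<omega>. Y \<omega> ^ 4)" "(\<integral>\<omega>. Y \<omega> ^ 4 \<partial>M) = 3 * (\<integral>\<omega>. (Y \<omega>)\<^sup>2 \<partial>M)\<^sup>2"
    by auto
qed

text \<open>The signs of b, c, d run through all 8 patterns, weighted by their product. Only
  monomials odd in each of b, c, d survive, that is a b c d, with coefficient 4! in each power;
  hence 192 = 8 * 24.\<close>

lemma polarization_fourth:
  fixes a b c d :: real
  shows "192 * (a * b * c * d) =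
    (a + b + c + d) ^ 4 - (a + b + c - d) ^ 4 - (a + b - c + d) ^ 4 + (a + b - c - d) ^ 4
    - (a - b + c + d) ^ 4 + (a - b + c - d) ^ 4 + (a - b - c + d) ^ 4 - (a - b - c - d) ^ 4"
  by (simp add: power4_eq_xxxx algebra_simps)

text \<open>Joint Gaussianity enters only through the fourth moments of linear combinations, so
  singular covariances need no separate treatment. Polarization recovers the mixed moment from
  them.\<close>

lemma (in finite_measure) isserlis_fourth:
  fixes a b c d :: "'a \<Rightarrow> real"
  assumes meas: "a \<in> borel_measurable M" "b \<in> borel_measurable M" "c \<in> borel_measurable M" "d \<in> borel_measurable M"
    and int4: "\<And>p q r s. integrable M (\<lambda>\<omega>. (p * a \<omega> + q * b \<omega> + r * c \<omega> + s * d \<omega>) ^ 4)"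
    and moment4: "\<And>p q r s. (\<integral>\<omega>. (p * a \<omega> + q * b \<omega> + r * c \<omega> + s * d \<omega>) ^ 4 \<partial>M)
      = 3 * (\<integral>\<omega>. (p * a \<omega> + q * b \<omega> + r * c \<omega> + s * d \<omega>)\<^sup>2 \<partial>M)\<^sup>2"
  shows isserlis_integrable: "integrable M (\<lambda>\<omega>. a \<omega> * b \<omega> * c \<omega> * d \<omega>)"
    and isserlis_integrable_pair: "integrable M (\<lambda>\<omega>. a \<omega> * b \<omega>)"
    and isserlis_integral: "(\<integral>\<omega>. a \<omega> * b \<omega> * c \<omega> * d \<omega> \<partial>M)
       = (\<integral>\<omega>. a \<omega> * b \<omega> \<partial>M) * (\<integral>\<omega>. c \<omega> * d \<omega> \<partial>M)
       + (\<integral>\<omega>. a \<omega> * c \<omega> \<partial>M) * (\<integral>\<omega>. b \<omega> * d \<omega> \<partial>M)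
       + (\<integral>\<omega>. a \<omega> * d \<omega> \<partial>M) * (\<integral>\<omega>. b \<omega> * c \<omega> \<partial>M)"
proof -
  note [measurable] = meas
  have sq: "integrable M (\<lambda>\<omega>. (f \<omega>)\<^sup>2)"
    if [measurable]: "f \<in> borel_measurable M" and f: "integrable M (\<lambda>\<omega>. f \<omega> ^ 4)" for f :: "'a \<Rightarrow> real"
  proof (rule Bochner_Integration.integrable_bound[where f = "\<lambda>\<omega>. 1 + f \<omega> ^ 4"])
    show "integrable M (\<lambda>\<omega>. 1 + f \<omega> ^ 4)" using f by simp
    have "x\<^sup>2 \<le> 1 + x ^ 4" for x :: real
    proof -
      have "0 \<le> (x\<^sup>2 - 1)\<^sup>2 + x\<^sup>2" by simp
      then show ?thesis by (simp add: power2_eq_square power4_eq_xxxx algebra_simps)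
    qed
    then show "AE \<omega> in M. norm ((f \<omega>)\<^sup>2) \<le> norm (1 + f \<omega> ^ 4)" by simp
  qed simp
  have lin: "integrable M (\<lambda>\<omega>. (p * a \<omega> + q * b \<omega> + r * c \<omega> + s * d \<omega>)\<^sup>2)" for p q r s
    by (intro sq int4) simp
  have prod: "integrable M (\<lambda>\<omega>. f \<omega> * g \<omega>)"
    if [measurable]: "f \<in> borel_measurable M" "g \<in> borel_measurable M"
      and "integrable M (\<lambda>\<omega>. (f \<omega>)\<^sup>2)" "integrable M (\<lambda>\<omega>. (g \<omega>)\<^sup>2)" for f g :: "'a \<Rightarrow> real"
  proof (rule Bochner_Integration.integrable_bound[where f = "\<lambda>\<omega>. (f \<omega>)\<^sup>2 + (g \<omega>)\<^sup>2"])
    have "\<bar>x * y\<bar> \<le> x\<^sup>2 + y\<^sup>2" for x y :: real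
      using zero_le_power2[of "x - y"] zero_le_power2[of "x + y"] zero_le_power2[of x] zero_le_power2[of y]
      by (auto simp: abs_le_iff power2_sum power2_diff)
    then show "AE \<omega> in M. norm (f \<omega> * g \<omega>) \<le> norm ((f \<omega>)\<^sup>2 + (g \<omega>)\<^sup>2)" by simp
  qed (use that in auto)
  have sq1: "integrable M (\<lambda>\<omega>. (a \<omega>)\<^sup>2)" "integrable M (\<lambda>\<omega>. (b \<omega>)\<^sup>2)" "integrable M (\<lambda>\<omega>. (c \<omega>)\<^sup>2)" "integrable M (\<lambda>\<omega>. (d \<omega>)\<^sup>2)"
    using lin[of 1 0 0 0] lin[of 0 1 0 0] lin[of 0 0 1 0] lin[of 0 0 0 1] by simp_all
  note prods = prod[OF meas(1) meas(2) sq1(1,2)] prod[OF meas(1) meas(3) sq1(1,3)] prod[OF meas(1) meas(4) sq1(1,4)]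
    prod[OF meas(2) meas(3) sq1(2,3)] prod[OF meas(2) meas(4) sq1(2,4)] prod[OF meas(3) meas(4) sq1(3,4)]
  show "integrable M (\<lambda>\<omega>. a \<omega> * b \<omega>)" by (rule prods)
  \<comment> \<open>Polarization varies only the signs of b, c, d, so the coefficient of a is fixed
    to 1.\<close>
  define f where "f q r s \<omega> = a \<omega> + q * b \<omega> + r * c \<omega> + s * d \<omega>" for q r s \<omega>
  define E where "E q r s = (\<integral>\<omega>. f q r s \<omega> ^ 4 \<partial>M)" for q r s
  have f4: "integrable M (\<lambda>\<omega>. f q r s \<omega> ^ 4)" for q r s
    using int4[of 1 q r s] by (simp add: f_def)
  have E: "E q r s = 3 * ((\<integral>\<omega>. (a \<omega>)\<^sup>2 \<partial>M) + q\<^sup>2 * (\<integral>\<omega>. (b \<omega>)\<^sup>2 \<partial>M) + r\<^sup>2 * (\<integral>\<omega>. (c \<omega>)\<^sup>2 \<partial>M) + s\<^sup>2 * (\<integral>\<omega>. (d \<omega>)\<^sup>2 \<partial>M)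
     + 2 * q * (\<integral>\<omega>. a \<omega> * b \<omega> \<partial>M) + 2 * r * (\<integral>\<omega>. a \<omega> * c \<omega> \<partial>M) + 2 * s * (\<integral>\<omega>. a \<omega> * d \<omega> \<partial>M)
     + 2 * q * r * (\<integral>\<omega>. b \<omega> * c \<omega> \<partial>M) + 2 * q * s * (\<integral>\<omega>. b \<omega> * d \<omega> \<partial>M) + 2 * r * s * (\<integral>\<omega>. c \<omega> * d \<omega> \<partial>M))\<^sup>2" for q r s
  proof -
    have "(f q r s \<omega>)\<^sup>2 = (a \<omega>)\<^sup>2 + q\<^sup>2 * (b \<omega>)\<^sup>2 + r\<^sup>2 * (c \<omega>)\<^sup>2 + s\<^sup>2 * (d \<omega>)\<^sup>2
       + 2 * q * (a \<omega> * b \<omega>) + 2 * r * (a \<omega> * c \<omega>) + 2 * s * (a \<omega> * d \<omega>)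
       + 2 * q * r * (b \<omega> * c \<omega>) + 2 * q * s * (b \<omega> * d \<omega>) + 2 * r * s * (c \<omega> * d \<omega>)" for \<omega>
      unfolding f_def by (simp add: power2_eq_square algebra_simps)
    then have "(\<integral>\<omega>. (f q r s \<omega>)\<^sup>2 \<partial>M) = (\<integral>\<omega>. (a \<omega>)\<^sup>2 \<partial>M) + q\<^sup>2 * (\<integral>\<omega>. (b \<omega>)\<^sup>2 \<partial>M) + r\<^sup>2 * (\<integral>\<omega>. (c \<omega>)\<^sup>2 \<partial>M) + s\<^sup>2 * (\<integral>\<omega>. (d \<omega>)\<^sup>2 \<partial>M)
     + 2 * q * (\<integral>\<omega>. a \<omega> * b \<omega> \<partial>M) + 2 * r * (\<integral>\<omega>. a \<omega> * c \<omega> \<partial>M) + 2 * s * (\<integral>\<omega>. a \<omega> * d \<omega> \<partial>M)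
     + 2 * q * r * (\<integral>\<omega>. b \<omega> * c \<omega> \<partial>M) + 2 * q * s * (\<integral>\<omega>. b \<omega> * d \<omega> \<partial>M) + 2 * r * s * (\<integral>\<omega>. c \<omega> * d \<omega> \<partial>M)"
      using sq1 prods by simp
    moreover have "E q r s = 3 * (\<integral>\<omega>. (f q r s \<omega>)\<^sup>2 \<partial>M)\<^sup>2"
      using moment4[of 1 q r s] by (simp add: E_def f_def)
    ultimately show ?thesis by simp
  qed
  have pol: "a \<omega> * b \<omega> * c \<omega> * d \<omega> = (f 1 1 1 \<omega> ^ 4 - f 1 1 (-1) \<omega> ^ 4 - f 1 (-1) 1 \<omega> ^ 4 + f 1 (-1) (-1) \<omega> ^ 4
     - f (-1) 1 1 \<omega> ^ 4 + f (-1) 1 (-1) \<omega> ^ 4 + f (-1) (-1) 1 \<omega> ^ 4 - f (-1) (-1) (-1) \<omega> ^ 4) / 192" for \<omega>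
    using polarization_fourth[of "a \<omega>" "b \<omega>" "c \<omega>" "d \<omega>"] by (simp add: f_def)
  show "integrable M (\<lambda>\<omega>. a \<omega> * b \<omega> * c \<omega> * d \<omega>)"
    unfolding pol using f4 by simp
  have "(\<integral>\<omega>. a \<omega> * b \<omega> * c \<omega> * d \<omega> \<partial>M) = (E 1 1 1 - E 1 1 (-1) - E 1 (-1) 1 + E 1 (-1) (-1)
     - E (-1) 1 1 + E (-1) 1 (-1) + E (-1) (-1) 1 - E (-1) (-1) (-1)) / 192"
    unfolding pol E_def using f4 by simp
  also have "\<dots> = (\<integral>\<omega>. a \<omega> * b \<omega> \<partial>M) * (\<integral>\<omega>. c \<omega> * d \<omega> \<partial>M)
       + (\<integral>\<omega>. a \<omega> * c \<omega> \<partial>M) * (\<integral>\<omega>. b \<omega> * d \<omega> \<partial>M)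
       + (\<integral>\<omega>. a \<omega> * d \<omega> \<partial>M) * (\<integral>\<omega>. b \<omega> * c \<omega> \<partial>M)"
    \<comment> \<open>The alternating sum extracts the coefficient of q r s in the squared second
      moment. It is made of the three products of complementary pairs.\<close>
    unfolding E by (simp add: field_simps power2_eq_square)
  finally show "(\<integral>\<omega>. a \<omega> * b \<omega> * c \<omega> * d \<omega> \<partial>M)
       = (\<integral>\<omega>. a \<omega> * b \<omega> \<partial>M) * (\<integral>\<omega>. c \<omega> * d \<omega> \<partial>M)
       + (\<integral>\<omega>. a \<omega> * c \<omega> \<partial>M) * (\<integral>\<omega>. b \<omega> * d \<omega> \<partial>M)
       + (\<integral>\<omega>. a \<omega> * d \<omega> \<partial>M) * (\<integral>\<omega>. b \<omega> * c \<omega> \<partial>M)" .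
qed

subsection \<open>Concentration of the quadratic forms\<close>

locale gaussian_sample = prob_space M for M :: "'w measure" +
  fixes n T :: nat and S :: "real mat" and X :: "'w \<Rightarrow> real mat" and z :: complex
  assumes T: "T > 0" and z: "Im z \<noteq> 0" and S: "S \<in> carrier_mat n n"
    and gaussian: "gaussian_columns M n T S X"
begin

lemma X_carrier: "\<omega> \<in> space M \<Longrightarrow> X \<omega> \<in> carrier_mat n T"
  using gaussian by (simp add: gaussian_columns_def)

lemma sample: "\<omega> \<in> space M \<Longrightarrow> resolvent_sample n T (X \<omega>) z"
  using T z X_carrier by unfold_locales

lemma gaussian_vec_col: "t < T \<Longrightarrow> gaussian_vec M n (\<lambda>\<omega>. col (X \<omega>) t)"
  using gaussian by (simp add: gaussian_columns_def)

lemma col_index: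
  assumes "\<omega> \<in> space M" "i < n" "t < T"
  shows "col (X \<omega>) t $ i = X \<omega> $$ (i, t)"
  using X_carrier[OF assms(1)] assms by auto

lemma unit_scalar_prod_col:
  assumes "\<omega> \<in> space M" "i < n" "t < T"
  shows "unit_vec n i \<bullet> col (X \<omega>) t = X \<omega> $$ (i, t)"
proof -
  have "col (X \<omega>) t \<in> carrier_vec n"
    using X_carrier[OF assms(1)] by auto
  then show ?thesis
    using assms by (simp add: col_index)
qed

lemma measurable_entry:
  assumes "i < n" "t < T"
  shows "(\<lambda>\<omega>. X \<omega> $$ (i, t)) \<in> borel_measurable M"
proof -
  have "(\<lambda>\<omega>. unit_vec n i \<bullet> col (X \<omega>) t) \<in> borel_measurable M"
    using gaussian_vec_col[OF assms(2)] unfolding gaussian_vec_def gaussian_rv_def by auto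
  then show ?thesis
    by (rule measurable_cong[THEN iffD1, rotated]) (simp add: unit_scalar_prod_col assms)
qed

lemma integral_entry:
  assumes "i < n" "t < T"
  shows "(\<integral>\<omega>. X \<omega> $$ (i, t) \<partial>M) = 0"
proof -
  have "mean_vec M n (\<lambda>\<omega>. col (X \<omega>) t) $ i = 0"
    using gaussian assms by (simp add: gaussian_columns_def)
  then have "(\<integral>\<omega>. col (X \<omega>) t $ i \<partial>M) = 0"
    using assms by (simp add: mean_vec_def)
  moreover have "(\<integral>\<omega>. col (X \<omega>) t $ i \<partial>M) = (\<integral>\<omega>. X \<omega> $$ (i, t) \<partial>M)"
    using assms by (intro Bochner_Integration.integral_cong) (auto simp: col_index)
  ultimately show ?thesis by simp
qed

lemma integral_entry_product:
  assumes "i < n" "j < n" "t < T"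
  shows "(\<integral>\<omega>. X \<omega> $$ (i, t) * X \<omega> $$ (j, t) \<partial>M) = S $$ (i, j)"
proof -
  have cov: "covariance_mat M n (\<lambda>\<omega>. col (X \<omega>) t) = S" and mean: "mean_vec M n (\<lambda>\<omega>. col (X \<omega>) t) = 0\<^sub>v n"
    using gaussian assms by (simp_all add: gaussian_columns_def)
  have "S $$ (i, j) = (\<integral>\<omega>. col (X \<omega>) t $ i * col (X \<omega>) t $ j \<partial>M)"
    using assms unfolding cov[symmetric] covariance_mat_def mean by simp
  also have "\<dots> = (\<integral>\<omega>. X \<omega> $$ (i, t) * X \<omega> $$ (j, t) \<partial>M)"
    using assms by (intro Bochner_Integration.integral_cong) (auto simp: col_index)
  finally show ?thesis by simp
qed

text \<open>\<open>integral_entry\<close> alone does not give this, since the integral of a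
  non-integrable function is 0 as well. Integrability is derived from the fourth moment by |x| \<le>
  1 + x^4.\<close>

lemma integrable_entry:
  assumes i: "i < n" and t: "t < T"
  shows "integrable M (\<lambda>\<omega>. X \<omega> $$ (i, t))"
proof -
  have g: "gaussian_rv M (\<lambda>\<omega>. unit_vec n i \<bullet> col (X \<omega>) t)"
    using gaussian_vec_col[OF t] unfolding gaussian_vec_def by simp
  have "(\<integral>\<omega>. unit_vec n i \<bullet> col (X \<omega>) t \<partial>M) = (\<integral>\<omega>. X \<omega> $$ (i, t) \<partial>M)"
    using i t by (intro Bochner_Integration.integral_cong) (auto simp: unit_scalar_prod_col)
  then have "(\<integral>\<omega>. unit_vec n i \<bullet> col (X \<omega>) t \<partial>M) = 0"
    unfolding integral_entry[OF i t] .
  then have "integrable M (\<lambda>\<omega>. (unit_vec n i \<bullet> col (X \<omega>) t) ^ 4)"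
    by (rule integrable_gaussian_fourth[OF g])
  moreover have "integrable M (\<lambda>\<omega>. (unit_vec n i \<bullet> col (X \<omega>) t) ^ 4) = integrable M (\<lambda>\<omega>. (X \<omega> $$ (i, t)) ^ 4)"
    using i t by (intro Bochner_Integration.integrable_cong) (auto simp: unit_scalar_prod_col)
  ultimately have int4: "integrable M (\<lambda>\<omega>. 1 + (X \<omega> $$ (i, t)) ^ 4)"
    by simp
  have "\<bar>x\<bar> \<le> 1 + x ^ 4" for x :: real
  proof -
    have "0 \<le> (x\<^sup>2 - 1)\<^sup>2 + (1 - \<bar>x\<bar>)\<^sup>2" by simp
    then have "2 * \<bar>x\<bar> \<le> 2 + x ^ 4 - x\<^sup>2"
      by (simp add: power2_eq_square power4_eq_xxxx algebra_simps)
    moreover have "0 \<le> x ^ 4" "0 \<le> x\<^sup>2" by simp_all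
    ultimately show ?thesis by linarith
  qed
  then show ?thesis
    using int4 measurable_entry[OF i t]
    by (intro Bochner_Integration.integrable_bound[OF int4]) auto
qed

text \<open>A linear combination of entries of one column is the scalar product with a fixed vector
  u, hence Gaussian. As u is a sum of multiples of unit vectors, coinciding indices are
  covered.\<close>

lemma linear_combination_fourth:
  assumes ijkl: "i < n" "j < n" "k < n" "l < n" and t: "t < T"
  shows "integrable M (\<lambda>\<omega>. (p * X \<omega> $$ (i, t) + q * X \<omega> $$ (j, t) + r * X \<omega> $$ (k, t) + s * X \<omega> $$ (l, t)) ^ 4)" (is ?int)
    and "(\<integral>\<omega>. (p * X \<omega> $$ (i, t) + q * X \<omega> $$ (j, t) + r * X \<omega> $$ (k, t) + s * X \<omega> $$ (l, t)) ^ 4 \<partial>M)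
      = 3 * (\<integral>\<omega>. (p * X \<omega> $$ (i, t) + q * X \<omega> $$ (j, t) + r * X \<omega> $$ (k, t) + s * X \<omega> $$ (l, t))\<^sup>2 \<partial>M)\<^sup>2" (is ?eq)
proof -
  define u where "u = p \<cdot>\<^sub>v unit_vec n i + q \<cdot>\<^sub>v unit_vec n j + r \<cdot>\<^sub>v unit_vec n k + s \<cdot>\<^sub>v unit_vec n l"
  define f where "f \<omega> = p * X \<omega> $$ (i, t) + q * X \<omega> $$ (j, t) + r * X \<omega> $$ (k, t) + s * X \<omega> $$ (l, t)" for \<omega>
  have u: "u \<in> carrier_vec n" by (simp add: u_def)
  have uf: "u \<bullet> col (X \<omega>) t = f \<omega>" if "\<omega> \<in> space M" for \<omega>
  proof -
    have c: "col (X \<omega>) t \<in> carrier_vec n"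
      using X_carrier[OF that] by auto
    show ?thesis
      using that ijkl t c unfolding u_def f_def
      by (simp add: add_scalar_prod_distrib[where n = n] smult_scalar_prod_distrib[where n = n] unit_scalar_prod_col
          del: scalar_prod_left_unit)
  qed
  have g: "gaussian_rv M (\<lambda>\<omega>. u \<bullet> col (X \<omega>) t)"
    using gaussian_vec_col[OF t] u unfolding gaussian_vec_def by simp
  have "(\<integral>\<omega>. u \<bullet> col (X \<omega>) t \<partial>M) = (\<integral>\<omega>. f \<omega> \<partial>M)"
    by (intro Bochner_Integration.integral_cong) (auto simp: uf)
  also have "\<dots> = 0"
    unfolding f_def using integrable_entry[OF _ t] integral_entry[OF _ t] ijkl by simp
  finally have mean: "(\<integral>\<omega>. u \<bullet> col (X \<omega>) t \<partial>M) = 0" .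
  have "integrable M (\<lambda>\<omega>. (u \<bullet> col (X \<omega>) t) ^ 4) = integrable M (\<lambda>\<omega>. f \<omega> ^ 4)"
    by (intro Bochner_Integration.integrable_cong) (auto simp: uf)
  then show ?int
    using integrable_gaussian_fourth[OF g mean] by (simp add: f_def)
  have pow: "(\<integral>\<omega>. (u \<bullet> col (X \<omega>) t) ^ m \<partial>M) = (\<integral>\<omega>. f \<omega> ^ m \<partial>M)" for m
    by (intro Bochner_Integration.integral_cong) (auto simp: uf)
  show ?eq
    using integral_gaussian_fourth[OF g mean] unfolding pow by (simp add: f_def)
qed

lemma entry_isserlis:
  assumes ijkl: "i < n" "j < n" "k < n" "l < n" and t: "t < T"
  shows integrable_entry_pair: "integrable M (\<lambda>\<omega>. X \<omega> $$ (i, t) * X \<omega> $$ (j, t))"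
    and integrable_entry_quadruple: "integrable M (\<lambda>\<omega>. X \<omega> $$ (i, t) * X \<omega> $$ (j, t) * X \<omega> $$ (k, t) * X \<omega> $$ (l, t))"
    and integral_entry_quadruple: "(\<integral>\<omega>. X \<omega> $$ (i, t) * X \<omega> $$ (j, t) * X \<omega> $$ (k, t) * X \<omega> $$ (l, t) \<partial>M)
      = S $$ (i, j) * S $$ (k, l) + S $$ (i, k) * S $$ (j, l) + S $$ (i, l) * S $$ (j, k)"
proof -
  note iss = isserlis_fourth[OF measurable_entry[OF ijkl(1) t] measurable_entry[OF ijkl(2) t] measurable_entry[OF ijkl(3) t]
    measurable_entry[OF ijkl(4) t] linear_combination_fourth[OF ijkl t]]
  show "integrable M (\<lambda>\<omega>. X \<omega> $$ (i, t) * X \<omega> $$ (j, t))" by (rule iss(2))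
  show "integrable M (\<lambda>\<omega>. X \<omega> $$ (i, t) * X \<omega> $$ (j, t) * X \<omega> $$ (k, t) * X \<omega> $$ (l, t))" by (rule iss(1))
  show "(\<integral>\<omega>. X \<omega> $$ (i, t) * X \<omega> $$ (j, t) * X \<omega> $$ (k, t) * X \<omega> $$ (l, t) \<partial>M)
      = S $$ (i, j) * S $$ (k, l) + S $$ (i, k) * S $$ (j, l) + S $$ (i, l) * S $$ (j, k)"
    unfolding iss(3) using ijkl t by (simp add: integral_entry_product)
qed

section \<open>Second moments of the centered quadratic forms\<close>

definition centered_product :: "nat \<Rightarrow> nat \<Rightarrow> nat \<Rightarrow> 'w \<Rightarrow> real" where
  "centered_product t i j \<omega> = X \<omega> $$ (i, t) * X \<omega> $$ (j, t) - S $$ (i, j)"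

text \<open>Centering cancels the pairing S (i, j) S (k, l) of Isserlis' formula. That pairing would
  contribute the squared modulus of Tr (H S), which can be of order n^2; the other two contribute
  only order n.\<close>

lemma centered_product_moments:
  assumes ijkl: "i < n" "j < n" "k < n" "l < n" and t: "t < T"
  shows integrable_centered_product: "integrable M (\<lambda>\<omega>. centered_product t i j \<omega> * centered_product t k l \<omega>)"
    and integral_centered_product: "(\<integral>\<omega>. centered_product t i j \<omega> * centered_product t k l \<omega> \<partial>M) = S $$ (i, k) * S $$ (j, l) + S $$ (i, l) * S $$ (j, k)"
proof -
  note int = integrable_entry_quadruple[OF ijkl t] integrable_entry_pair[OF ijkl t] integrable_entry_pair[OF ijkl(3,4,1,2) t]
  have eq: "centered_product t i j \<omega> * centered_product t k l \<omega> = X \<omega> $$ (i, t) * X \<omega> $$ (j, t) * X \<omega> $$ (k, t) * X \<omega> $$ (l, t)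
      - S $$ (k, l) * (X \<omega> $$ (i, t) * X \<omega> $$ (j, t)) - S $$ (i, j) * (X \<omega> $$ (k, t) * X \<omega> $$ (l, t))
      + S $$ (i, j) * S $$ (k, l)" for \<omega>
    by (simp add: centered_product_def algebra_simps)
  show "integrable M (\<lambda>\<omega>. centered_product t i j \<omega> * centered_product t k l \<omega>)"
    unfolding eq using int by simp
  show "(\<integral>\<omega>. centered_product t i j \<omega> * centered_product t k l \<omega> \<partial>M) = S $$ (i, k) * S $$ (j, l) + S $$ (i, l) * S $$ (j, k)"
    unfolding eq using int integral_entry_quadruple[OF ijkl t] ijkl t
    by (simp add: integral_entry_product prob_space)
qed

definition B :: "nat \<Rightarrow> nat \<Rightarrow> nat \<Rightarrow> 'w \<Rightarrow> complex" where
  "B t i j \<omega> = resolvent (empirical_cov T (zero_col (X \<omega>) t)) z $$ (i, j)"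

lemma zero_col_sample: "\<omega> \<in> space M \<Longrightarrow> resolvent_sample n T (zero_col (X \<omega>) t) z"
  by (rule resolvent_sample.zero_col_sample[OF sample])

lemma measurable_B:
  assumes ij: "i < n" "j < n"
  shows "B t i j \<in> borel_measurable M"
proof -
  have "(\<lambda>\<omega>. resolvent (empirical_cov T (zero_col (X \<omega>) t)) z $$ (i, j)) \<in> borel_measurable M"
  proof (rule borel_measurable_resolvent[OF T z _ _ ij])
    show "zero_col (X \<omega>) t \<in> carrier_mat n T" if "\<omega> \<in> space M" for \<omega>
      using X_carrier[OF that] by (auto simp: zero_col_def)
    fix k s assume ks: "k < n" "s < T"
    have "(\<lambda>\<omega>. if s = t then 0 else X \<omega> $$ (k, s)) \<in> borel_measurable M"
      using measurable_entry[OF ks] by simp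
    then show "(\<lambda>\<omega>. zero_col (X \<omega>) t $$ (k, s)) \<in> borel_measurable M"
      by (rule measurable_cong[THEN iffD1, rotated]) (use ks X_carrier in \<open>fastforce simp: zero_col_def\<close>)
  qed
  then show ?thesis by (simp add: B_def[abs_def])
qed

lemma B_bound: "\<omega> \<in> space M \<Longrightarrow> i < n \<Longrightarrow> j < n \<Longrightarrow> cmod (B t i j \<omega>) \<le> 1 / \<bar>Im z\<bar>"
  unfolding B_def by (rule resolvent_sample.R_entry_bound[OF zero_col_sample])

lemma integrable_B_product:
  assumes ijkl: "i < n" "j < n" "k < n" "l < n"
  shows "integrable M (\<lambda>\<omega>. B t i j \<omega> * cnj (B t k l \<omega>))"
proof (rule integrable_const_bound)
  show "AE \<omega> in M. norm (B t i j \<omega> * cnj (B t k l \<omega>)) \<le> 1 / \<bar>Im z\<bar> * (1 / \<bar>Im z\<bar>)"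
    unfolding norm_mult complex_mod_cnj by (intro AE_I2 mult_mono B_bound ijkl) auto
qed (intro borel_measurable_times borel_measurable_cnj measurable_B ijkl)

text \<open>The first factor is a function of column t and the second one of the remaining columns,
  so the expectation factorises. The work lies in exhibiting both as measurable functions on product
  spaces.\<close>

lemma centered_product_indep_B:
  assumes ijkl: "i < n" "j < n" "k < n" "l < n" and t: "t < T"
  shows integrable_centered_product_B: "integrable M (\<lambda>\<omega>. of_real (centered_product t i j \<omega> * centered_product t k l \<omega>) * (B t i j \<omega> * cnj (B t k l \<omega>)))"
    and integral_centered_product_B: "(\<integral>\<omega>. of_real (centered_product t i j \<omega> * centered_product t k l \<omega>) * (B t i j \<omega> * cnj (B t k l \<omega>)) \<partial>M)
      = of_real (S $$ (i, k) * S $$ (j, l) + S $$ (i, l) * S $$ (j, k)) * (\<integral>\<omega>. B t i j \<omega> * cnj (B t k l \<omega>) \<partial>M)"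
proof -
  let ?N = "\<lambda>t::nat. PiM {..<n} (\<lambda>i. borel :: real measure)"
  let ?Y = "\<lambda>t \<omega>. \<lambda>i\<in>{..<n}. col (X \<omega>) t $ i"
  let ?J = "{..<T} - {t}"
  define f where "f y = complex_of_real ((y t i * y t j - S $$ (i, j)) * (y t k * y t l - S $$ (k, l)))" for y :: "nat \<Rightarrow> nat \<Rightarrow> real"
  \<comment> \<open>The matrix is rebuilt with column t set to zero, so it reads only the columns in
    \<open>?J\<close>; \<open>y\<close> takes the column index first.\<close>
  define m where "m y = mat n T (\<lambda>(r, s). if s = t then 0 else y s r)" for y :: "nat \<Rightarrow> nat \<Rightarrow> real"
  define g where "g y = resolvent (empirical_cov T (m y)) z $$ (i, j) * cnj (resolvent (empirical_cov T (m y)) z $$ (k, l))" for y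
  define F where "F = f \<circ> (\<lambda>\<omega>. restrict (\<lambda>t. ?Y t \<omega>) {t})"
  define G where "G = g \<circ> (\<lambda>\<omega>. restrict (\<lambda>t. ?Y t \<omega>) ?J)"
  have "indep_vars ?N ?Y {..<T}"
    using gaussian by (simp add: gaussian_columns_def)
  then have indep: "indep_var (PiM {t} ?N) (\<lambda>\<omega>. restrict (\<lambda>t. ?Y t \<omega>) {t}) (PiM ?J ?N) (\<lambda>\<omega>. restrict (\<lambda>t. ?Y t \<omega>) ?J)"
    using t by (intro indep_var_restrict) auto
  have comp: "(\<lambda>y. y s r) \<in> borel_measurable (PiM J ?N)" if "s \<in> J" "r < n" for s r J
  proof -
    have "(\<lambda>x. x r) \<in> borel_measurable (?N s)"
      using that by (intro measurable_component_singleton[where M = "\<lambda>i. borel"]) auto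
    from measurable_compose[OF measurable_component_singleton[OF that(1)] this] show ?thesis .
  qed
  have f: "f \<in> borel_measurable (PiM {t} ?N)"
    unfolding f_def using ijkl
    by (intro measurable_compose[OF _ borel_measurable_of_real] borel_measurable_times borel_measurable_diff
      borel_measurable_const comp) auto
  have res: "(\<lambda>y. resolvent (empirical_cov T (m y)) z $$ (r, s)) \<in> borel_measurable (PiM ?J ?N)" if "r < n" "s < n" for r s
  proof (rule borel_measurable_resolvent[OF T z _ _ that])
    show "m y \<in> carrier_mat n T" for y by (simp add: m_def)
    show "(\<lambda>y. m y $$ (r, s)) \<in> borel_measurable (PiM ?J ?N)" if "r < n" "s < T" for r s
      using that comp[of s ?J r] by (cases "s = t") (auto simp: m_def)
  qed
  have g: "g \<in> borel_measurable (PiM ?J ?N)"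
    unfolding g_def by (intro borel_measurable_times borel_measurable_cnj res ijkl)
  have FG: "indep_var borel F borel G"
    unfolding F_def G_def by (rule indep_var_compose[OF indep f g])
  have F: "F \<omega> = of_real (centered_product t i j \<omega> * centered_product t k l \<omega>)" if "\<omega> \<in> space M" for \<omega>
    using that ijkl t by (simp add: F_def f_def centered_product_def col_index)
  have G: "G \<omega> = B t i j \<omega> * cnj (B t k l \<omega>)" if \<omega>: "\<omega> \<in> space M" for \<omega>
  proof -
    have "m (restrict (\<lambda>t. ?Y t \<omega>) ?J) = zero_col (X \<omega>) t"
      using X_carrier[OF \<omega>] by (intro eq_matI) (auto simp: m_def zero_col_def)
    then show ?thesis by (simp add: G_def g_def B_def)
  qed
  have intF: "integrable M F"
  proof -
    have "integrable M (\<lambda>\<omega>. complex_of_real (centered_product t i j \<omega> * centered_product t k l \<omega>))"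
      using integrable_centered_product[OF ijkl t] by (rule integrable_of_real)
    then show ?thesis
      by (rule Bochner_Integration.integrable_cong[THEN iffD1, rotated 2]) (simp_all add: F)
  qed
  have intG: "integrable M G"
    using integrable_B_product[OF ijkl]
    by (rule Bochner_Integration.integrable_cong[THEN iffD1, rotated 2]) (simp_all add: G)
  show "integrable M (\<lambda>\<omega>. of_real (centered_product t i j \<omega> * centered_product t k l \<omega>) * (B t i j \<omega> * cnj (B t k l \<omega>)))"
    using indep_var_integrable[OF FG intF intG]
    by (rule Bochner_Integration.integrable_cong[THEN iffD1, rotated 2]) (simp_all add: F G)
  have "(\<integral>\<omega>. of_real (centered_product t i j \<omega> * centered_product t k l \<omega>) * (B t i j \<omega> * cnj (B t k l \<omega>)) \<partial>M) = (\<integral>\<omega>. F \<omega> * G \<omega> \<partial>M)"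
    by (intro Bochner_Integration.integral_cong) (simp_all add: F G)
  also have "\<dots> = (\<integral>\<omega>. F \<omega> \<partial>M) * (\<integral>\<omega>. G \<omega> \<partial>M)"
    by (rule indep_var_lebesgue_integral[OF FG intF intG])
  also have "(\<integral>\<omega>. F \<omega> \<partial>M) = (\<integral>\<omega>. complex_of_real (centered_product t i j \<omega> * centered_product t k l \<omega>) \<partial>M)"
    by (intro Bochner_Integration.integral_cong) (simp_all add: F)
  also have "\<dots> = of_real (S $$ (i, k) * S $$ (j, l) + S $$ (i, l) * S $$ (j, k))"
    by (simp only: integral_complex_of_real integral_centered_product[OF ijkl t])
  also have "(\<integral>\<omega>. G \<omega> \<partial>M) = (\<integral>\<omega>. B t i j \<omega> * cnj (B t k l \<omega>) \<partial>M)"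
    by (intro Bochner_Integration.integral_cong) (simp_all add: G)
  finally show "(\<integral>\<omega>. of_real (centered_product t i j \<omega> * centered_product t k l \<omega>) * (B t i j \<omega> * cnj (B t k l \<omega>)) \<partial>M)
      = of_real (S $$ (i, k) * S $$ (j, l) + S $$ (i, l) * S $$ (j, k)) * (\<integral>\<omega>. B t i j \<omega> * cnj (B t k l \<omega>) \<partial>M)" .
qed

text \<open>By \<open>a_minus_L_fun\<close> this is T times the deviation of a from the L of the
  matrix without column t.\<close>

definition centered_form :: "nat \<Rightarrow> 'w \<Rightarrow> complex" where
  "centered_form t \<omega> = (\<Sum>i<n. \<Sum>j<n. of_real (centered_product t i j \<omega>) * B t i j \<omega>)"

lemma centered_form_norm_square:
  "of_real ((cmod (centered_form t \<omega>))\<^sup>2) = (\<Sum>i<n. \<Sum>j<n. \<Sum>k<n. \<Sum>l<n.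
      of_real (centered_product t i j \<omega> * centered_product t k l \<omega>) * (B t i j \<omega> * cnj (B t k l \<omega>)))"
proof -
  have cnj: "cnj (centered_form t \<omega>) = (\<Sum>k<n. \<Sum>l<n. of_real (centered_product t k l \<omega>) * cnj (B t k l \<omega>))"
    by (simp add: centered_form_def)
  have "of_real ((cmod (centered_form t \<omega>))\<^sup>2) = centered_form t \<omega> * cnj (centered_form t \<omega>)"
    by (rule complex_norm_square)
  also have "\<dots> = (\<Sum>i<n. \<Sum>j<n. of_real (centered_product t i j \<omega>) * B t i j \<omega> * cnj (centered_form t \<omega>))"
    \<comment> \<open>The instantiated definition rewrites \<open>centered_form\<close> only as a
      left factor, so that the conjugate stays folded.\<close>
    unfolding centered_form_def[of t \<omega>, THEN arg_cong, of "\<lambda>x. x * _"] sum_distrib_right ..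
  also have "\<dots> = (\<Sum>i<n. \<Sum>j<n. \<Sum>k<n. \<Sum>l<n.
      of_real (centered_product t i j \<omega> * centered_product t k l \<omega>) * (B t i j \<omega> * cnj (B t k l \<omega>)))"
    unfolding cnj sum_distrib_left by (intro sum.cong refl) (simp add: mult_ac)
  finally show ?thesis .
qed

text \<open>The two pairings give the same sum because the resolvent is symmetric, hence the factor
  2. The factor n is the Frobenius bound on the resolvent.\<close>

lemma covariance_form_bound:
  assumes \<omega>: "\<omega> \<in> space M"
  shows "cmod (\<Sum>i<n. \<Sum>j<n. \<Sum>k<n. \<Sum>l<n.
      of_real (S $$ (i, k) * S $$ (j, l) + S $$ (i, l) * S $$ (j, k)) * (B t i j \<omega> * cnj (B t k l \<omega>)))
    \<le> 2 * (op_norm S)\<^sup>2 * n / (Im z)\<^sup>2"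
proof -
  interpret Y: resolvent_sample n T "zero_col (X \<omega>) t" z by (rule zero_col_sample[OF \<omega>])
  let ?b = "\<lambda>i j. B t i j \<omega>"
  let ?f = "\<Sum>i<n. \<Sum>j<n. \<Sum>k<n. \<Sum>l<n. complex_of_real (S $$ (i, k) * S $$ (j, l)) * (?b i j * cnj (?b k l))"
  have swap: "(\<Sum>k<n. \<Sum>l<n. complex_of_real (S $$ (i, l) * S $$ (j, k)) * (?b i j * cnj (?b k l)))
      = (\<Sum>k<n. \<Sum>l<n. complex_of_real (S $$ (i, k) * S $$ (j, l)) * (?b i j * cnj (?b k l)))" for i j
    by (subst sum.swap) (auto intro!: sum.cong simp: B_def Y.R_sym_index)
  have "(\<Sum>i<n. \<Sum>j<n. \<Sum>k<n. \<Sum>l<n.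
      complex_of_real (S $$ (i, k) * S $$ (j, l) + S $$ (i, l) * S $$ (j, k)) * (?b i j * cnj (?b k l))) = ?f + ?f"
    by (simp only: of_real_add distrib_right sum.distrib swap)
  then have "cmod (\<Sum>i<n. \<Sum>j<n. \<Sum>k<n. \<Sum>l<n.
      complex_of_real (S $$ (i, k) * S $$ (j, l) + S $$ (i, l) * S $$ (j, k)) * (?b i j * cnj (?b k l))) \<le> cmod ?f + cmod ?f"
    using norm_triangle_ineq[of ?f ?f] by simp
  also have "cmod ?f \<le> (op_norm S)\<^sup>2 * (\<Sum>i<n. \<Sum>j<n. (cmod (?b i j))\<^sup>2)"
    by (rule op_norm_frobenius_form[OF S])
  also have "\<dots> \<le> (op_norm S)\<^sup>2 * (n / (Im z)\<^sup>2)"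
    unfolding B_def by (intro mult_left_mono Y.R_frobenius) simp
  finally show ?thesis by (simp add: mult.commute[of "real n"])
qed

text \<open>Independence replaces each Gaussian factor by its expectation while the factors
  \<open>B\<close> stay random. Summed back under the integral, the result is a form that
  \<open>covariance_form_bound\<close> controls at each outcome.\<close>

lemma centered_form_second_moment:
  assumes t: "t < T"
  shows integrable_centered_form_square: "integrable M (\<lambda>\<omega>. (cmod (centered_form t \<omega>))\<^sup>2)"
    and integral_centered_form_square: "(\<integral>\<omega>. (cmod (centered_form t \<omega>))\<^sup>2 \<partial>M) \<le> 2 * (op_norm S)\<^sup>2 * n / (Im z)\<^sup>2"
proof -
  let ?c = "\<lambda>i j k l. complex_of_real (S $$ (i, k) * S $$ (j, l) + S $$ (i, l) * S $$ (j, k))"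
  let ?BB = "\<lambda>i j k l \<omega>. B t i j \<omega> * cnj (B t k l \<omega>)"
  have int: "integrable M (\<lambda>\<omega>. complex_of_real ((cmod (centered_form t \<omega>))\<^sup>2))"
    unfolding centered_form_norm_square by (intro Bochner_Integration.integrable_sum integrable_centered_product_B) (auto simp: t)
  from integrable_Re[OF this] show int': "integrable M (\<lambda>\<omega>. (cmod (centered_form t \<omega>))\<^sup>2)"
    by simp
  have "complex_of_real (\<integral>\<omega>. (cmod (centered_form t \<omega>))\<^sup>2 \<partial>M) = (\<integral>\<omega>. complex_of_real ((cmod (centered_form t \<omega>))\<^sup>2) \<partial>M)"
    by (rule integral_complex_of_real[symmetric])
  also have "\<dots> = (\<Sum>i<n. \<Sum>j<n. \<Sum>k<n. \<Sum>l<n. \<integral>\<omega>. of_real (centered_product t i j \<omega> * centered_product t k l \<omega>) * ?BB i j k l \<omega> \<partial>M)"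
    unfolding centered_form_norm_square using t
    by (subst Bochner_Integration.integral_sum, (intro Bochner_Integration.integrable_sum integrable_centered_product_B; simp),
        intro sum.cong refl)+
  also have "\<dots> = (\<Sum>i<n. \<Sum>j<n. \<Sum>k<n. \<Sum>l<n. \<integral>\<omega>. ?c i j k l * ?BB i j k l \<omega> \<partial>M)"
    using t by (intro sum.cong refl) (simp add: integral_centered_product_B del: of_real_add of_real_mult)
  also have "\<dots> = (\<integral>\<omega>. (\<Sum>i<n. \<Sum>j<n. \<Sum>k<n. \<Sum>l<n. ?c i j k l * ?BB i j k l \<omega>) \<partial>M)"
    by (subst Bochner_Integration.integral_sum, (intro Bochner_Integration.integrable_sum integrable_mult_right integrable_B_product; simp),
        intro sum.cong refl)+
  finally have eq: "complex_of_real (\<integral>\<omega>. (cmod (centered_form t \<omega>))\<^sup>2 \<partial>M)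
      = (\<integral>\<omega>. (\<Sum>i<n. \<Sum>j<n. \<Sum>k<n. \<Sum>l<n. ?c i j k l * ?BB i j k l \<omega>) \<partial>M)" .
  have int_form: "integrable M (\<lambda>\<omega>. \<Sum>i<n. \<Sum>j<n. \<Sum>k<n. \<Sum>l<n. ?c i j k l * ?BB i j k l \<omega>)"
    by (intro Bochner_Integration.integrable_sum integrable_mult_right integrable_B_product) auto
  have "(\<integral>\<omega>. (cmod (centered_form t \<omega>))\<^sup>2 \<partial>M) \<le> cmod (complex_of_real (\<integral>\<omega>. (cmod (centered_form t \<omega>))\<^sup>2 \<partial>M))"
    by simp
  also have "\<dots> \<le> (\<integral>\<omega>. cmod (\<Sum>i<n. \<Sum>j<n. \<Sum>k<n. \<Sum>l<n. ?c i j k l * ?BB i j k l \<omega>) \<partial>M)"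
    unfolding eq by (rule integral_norm_bound)
  also have "\<dots> \<le> 2 * (op_norm S)\<^sup>2 * n / (Im z)\<^sup>2"
    using int_form by (intro integral_le_const integrable_norm AE_I2 covariance_form_bound)
  finally show "(\<integral>\<omega>. (cmod (centered_form t \<omega>))\<^sup>2 \<partial>M) \<le> 2 * (op_norm S)\<^sup>2 * n / (Im z)\<^sup>2" .
qed

lemma mean_deviation_prob:
  assumes \<delta>: "\<delta> > 0"
  shows "prob {\<omega> \<in> space M. (\<Sum>t<T. cmod (centered_form t \<omega>) / T) / T \<ge> \<delta>} \<le> 2 * (op_norm S)\<^sup>2 * n / ((Im z)\<^sup>2 * T\<^sup>2 * \<delta>\<^sup>2)"
proof -
  \<comment> \<open>The average over t of |\<open>centered_form\<close> / T|^2: one factor T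
    averages and two come from the scaling. It dominates the square of the average.\<close>
  define V where "V \<omega> = (\<Sum>t<T. (cmod (centered_form t \<omega>))\<^sup>2) / real T ^ 3" for \<omega>
  have intV: "integrable M V"
    unfolding V_def[abs_def]
    by (intro Bochner_Integration.integrable_divide Bochner_Integration.integrable_sum integrable_centered_form_square) auto
  have sq: "((\<Sum>t<T. cmod (centered_form t \<omega>) / T) / T)\<^sup>2 \<le> V \<omega>" for \<omega>
  proof -
    have "((\<Sum>t<T. cmod (centered_form t \<omega>) / T) / T)\<^sup>2 = (\<Sum>t<T. cmod (centered_form t \<omega>))\<^sup>2 / real T ^ 4"
      by (simp add: power_divide power2_eq_square power4_eq_xxxx flip: sum_divide_distrib)
    also have "\<dots> \<le> ((\<Sum>t<T. (cmod (centered_form t \<omega>))\<^sup>2) * card {..<T}) / real T ^ 4"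
      by (intro divide_right_mono sum_squared_le_sum_of_squares) simp
    also have "\<dots> = V \<omega>"
      using T by (simp add: V_def power3_eq_cube power4_eq_xxxx)
    finally show ?thesis .
  qed
  have "{\<omega> \<in> space M. (\<Sum>t<T. cmod (centered_form t \<omega>) / T) / T \<ge> \<delta>} \<subseteq> {\<omega> \<in> space M. V \<omega> \<ge> \<delta>\<^sup>2}"
  proof safe
    fix \<omega> assume "\<delta> \<le> (\<Sum>t<T. cmod (centered_form t \<omega>) / T) / T"
    then have "\<delta>\<^sup>2 \<le> ((\<Sum>t<T. cmod (centered_form t \<omega>) / T) / T)\<^sup>2"
      using \<delta> by (intro power_mono) auto
    then show "\<delta>\<^sup>2 \<le> V \<omega>" using sq[of \<omega>] by linarith
  qed
  then have "prob {\<omega> \<in> space M. (\<Sum>t<T. cmod (centered_form t \<omega>) / T) / T \<ge> \<delta>} \<le> prob {\<omega> \<in> space M. V \<omega> \<ge> \<delta>\<^sup>2}"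
    using borel_measurable_integrable[OF intV] by (intro finite_measure_mono) auto
  also have "\<dots> \<le> (\<integral>\<omega>. V \<omega> \<partial>M) / \<delta>\<^sup>2"
    using \<delta> by (intro integral_Markov_inequality_measure[OF intV sets.empty_sets]) (auto simp: V_def sum_nonneg)
  also have "\<dots> \<le> (2 * (op_norm S)\<^sup>2 * n / ((Im z)\<^sup>2 * T\<^sup>2)) / \<delta>\<^sup>2"
  proof (intro divide_right_mono)
    have "(\<integral>\<omega>. V \<omega> \<partial>M) = (\<Sum>t<T. \<integral>\<omega>. (cmod (centered_form t \<omega>))\<^sup>2 \<partial>M) / real T ^ 3"
      unfolding V_def integral_divide_zero
      by (subst Bochner_Integration.integral_sum) (auto intro: integrable_centered_form_square)
    also have "\<dots> \<le> (\<Sum>t<T. 2 * (op_norm S)\<^sup>2 * n / (Im z)\<^sup>2) / real T ^ 3"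
      using integral_centered_form_square by (intro divide_right_mono sum_mono) auto
    also have "\<dots> = 2 * (op_norm S)\<^sup>2 * n / ((Im z)\<^sup>2 * T\<^sup>2)"
      using T by (simp add: power3_eq_cube power2_eq_square[of "real T"])
    finally show "(\<integral>\<omega>. V \<omega> \<partial>M) \<le> 2 * (op_norm S)\<^sup>2 * n / ((Im z)\<^sup>2 * T\<^sup>2)" .
  qed simp
  finally show ?thesis by simp
qed

section \<open>From the quadratic forms to the error term\<close>

definition error_term :: "'w \<Rightarrow> complex" where
  "error_term \<omega> = L_fun T S (X \<omega>) z - (1 - 1 / (1 - complex_of_real (real n / T) + z * G_fun T (X \<omega>) z))"

lemma measurable_error_term: "error_term \<in> borel_measurable M"
proof -
  let ?R = "\<lambda>i j \<omega>. resolvent (empirical_cov T (X \<omega>)) z $$ (i, j)"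
  have R: "?R i j \<in> borel_measurable M" if "i < n" "j < n" for i j
    by (intro borel_measurable_resolvent[OF T z X_carrier measurable_entry that])
  have "(\<lambda>\<omega>. (\<Sum>i<n. \<Sum>j<n. of_real (S $$ (i, j)) * ?R j i \<omega>) / T
      - (1 - 1 / (1 - complex_of_real (real n / T) + z * (1 / of_nat T * (\<Sum>i<n. ?R i i \<omega>))))) \<in> borel_measurable M"
    by (intro borel_measurable_diff borel_measurable_add borel_measurable_divide borel_measurable_times
      borel_measurable_sum borel_measurable_const R) auto
  then show ?thesis
  proof (rule measurable_cong[THEN iffD1, rotated])
    fix \<omega> assume \<omega>: "\<omega> \<in> space M"
    interpret resolvent_sample n T "X \<omega>" z by (rule sample[OF \<omega>])
    show "(\<Sum>i<n. \<Sum>j<n. of_real (S $$ (i, j)) * ?R j i \<omega>) / T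
      - (1 - 1 / (1 - complex_of_real (real n / T) + z * (1 / of_nat T * (\<Sum>i<n. ?R i i \<omega>)))) = error_term \<omega>"
      unfolding error_term_def L_fun_eq[OF S] G_fun_def trace_resolvent ..
  qed
qed

text \<open>Half of \<eta> goes to the fluctuation and half to the change of L under removal of a
  column; the factor |Im z| / |z| cancels the prefactor in
  \<open>deterministic_equivalent\<close>.\<close>

lemma error_term_bound:
  assumes \<omega>: "\<omega> \<in> space M"
    and small: "(\<Sum>t<T. cmod (centered_form t \<omega>) / T) / T < \<eta> / 2 * (\<bar>Im z\<bar> / cmod z)"
    and large: "op_norm S / (\<bar>Im z\<bar> * T) \<le> \<eta> / 2 * (\<bar>Im z\<bar> / cmod z)"
    and \<eta>: "\<eta> \<le> 1 / 2"
  shows "cmod (error_term \<omega>) \<le> 2 * \<eta> * (1 + op_norm S * n / (\<bar>Im z\<bar> * T))"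
proof -
  interpret resolvent_sample n T "X \<omega>" z by (rule sample[OF \<omega>])
  have z0: "z \<noteq> 0" using z by auto
  have dev: "a t - L_fun T S (zero_col (X \<omega>) t) z = centered_form t \<omega> / T" for t
    by (simp add: a_minus_L_fun[OF S] centered_form_def centered_product_def B_def)
  let ?e = "(1 - of_real (real n / T) + z * G_fun T (X \<omega>) z) * (1 - L_fun T S (X \<omega>) z) - 1"
  have "cmod ?e \<le> cmod z / \<bar>Im z\<bar> * ((\<Sum>t<T. cmod (centered_form t \<omega>) / T) / T + op_norm S / (\<bar>Im z\<bar> * T))"
    using deterministic_equivalent[OF S] unfolding dev by (simp add: norm_divide)
  also have "\<dots> \<le> cmod z / \<bar>Im z\<bar> * (\<eta> * (\<bar>Im z\<bar> / cmod z))"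
    using small large by (intro mult_left_mono) auto
  also have "\<dots> = \<eta>" using z z0 by simp
  finally have e: "cmod ?e \<le> \<eta>" .
  have "cmod (error_term \<omega>) \<le> 2 * \<eta> * (1 + cmod (L_fun T S (X \<omega>) z))"
    unfolding error_term_def by (rule inverse_perturbation[OF e \<eta>])
  also have "\<dots> \<le> 2 * \<eta> * (1 + op_norm S * n / (\<bar>Im z\<bar> * T))"
    using L_fun_bound[OF S] order_trans[OF norm_ge_zero e] by (intro mult_left_mono) auto
  finally show ?thesis .
qed

lemma error_term_prob:
  assumes \<eta>: "\<eta> > 0" "\<eta> \<le> 1 / 2"
    and large: "op_norm S / (\<bar>Im z\<bar> * T) \<le> \<eta> / 2 * (\<bar>Im z\<bar> / cmod z)"
    and \<epsilon>: "2 * \<eta> * (1 + op_norm S * n / (\<bar>Im z\<bar> * T)) \<le> \<epsilon>"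
  shows "prob {\<omega> \<in> space M. cmod (error_term \<omega>) > \<epsilon>} \<le> 2 * (op_norm S)\<^sup>2 * n / ((Im z)\<^sup>2 * T\<^sup>2 * (\<eta> / 2 * (\<bar>Im z\<bar> / cmod z))\<^sup>2)"
proof -
  let ?\<delta> = "\<eta> / 2 * (\<bar>Im z\<bar> / cmod z)"
  have "z \<noteq> 0" using z by auto
  then have \<delta>: "?\<delta> > 0" using \<eta> z by simp
  \<comment> \<open>Monotonicity of the measure requires the larger event to be measurable.\<close>
  have "(\<lambda>\<omega>. (\<Sum>t<T. cmod (centered_form t \<omega>) / T) / T) \<in> borel_measurable M"
  proof -
    have "centered_product t i j \<in> borel_measurable M" if "i < n" "j < n" "t < T" for t i j
      unfolding centered_product_def[abs_def] using measurable_entry that by simp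
    then have "centered_form t \<in> borel_measurable M" if "t < T" for t
      unfolding centered_form_def[abs_def] using that
      by (intro borel_measurable_sum borel_measurable_times measurable_compose[OF _ borel_measurable_of_real] measurable_B) auto
    then show ?thesis by simp
  qed
  then have "prob {\<omega> \<in> space M. cmod (error_term \<omega>) > \<epsilon>} \<le> prob {\<omega> \<in> space M. (\<Sum>t<T. cmod (centered_form t \<omega>) / T) / T \<ge> ?\<delta>}"
    using error_term_bound[OF _ _ large \<eta>(2)] \<epsilon> by (intro finite_measure_mono) (auto simp: not_le[symmetric] intro: order_trans)
  also note mean_deviation_prob[OF \<delta>]
  finally show ?thesis .
qed

end

subsection \<open>Convergence in probability\<close>

theorem theorem1p1:
  fixes n T :: "nat \<Rightarrow> nat"
    and \<Sigma> :: "nat \<Rightarrow> real mat"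
    and q :: "nat \<Rightarrow> real"
    and M :: "nat \<Rightarrow> 'w measure"
    and X :: "nat \<Rightarrow> 'w \<Rightarrow> real mat"
    and z :: complex
  assumes "\<And>m. m \<ge> 1 \<Longrightarrow> n m > 0"
    and "\<And>m. m \<ge> 1 \<Longrightarrow> T m > 0"
    and "filterlim n at_top sequentially"
    and "filterlim T at_top sequentially"
    and "\<And>m. m \<ge> 1 \<Longrightarrow> \<Sigma> m \<in> carrier_mat (n m) (n m)"
    and "\<And>m. m \<ge> 1 \<Longrightarrow> pos_semidef_mat (\<Sigma> m)"
    and "\<And>m. m \<ge> 1 \<Longrightarrow> mat_trace (\<Sigma> m) > 0"
    and "\<And>m. q m = real (n m) / real (T m)"
    and "Bseq q"
    and "Bseq (\<lambda>m. op_norm (\<Sigma> m))"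
    and "Bseq (\<lambda>m. real (T m) / mat_trace (\<Sigma> m))"
    and "\<And>m. m \<ge> 1 \<Longrightarrow> prob_space (M m)"
    and "\<And>m. m \<ge> 1 \<Longrightarrow> gaussian_columns (M m) (n m) (T m) (\<Sigma> m) (X m)"
    and "z \<notin> \<real>"
  shows "tendsto_zero_in_prob M (\<lambda>m \<omega>. L_fun (T m) (\<Sigma> m) (X m \<omega>) z -
           (1 - 1 / (1 - complex_of_real (q m) + z * G_fun (T m) (X m \<omega>) z)))"
proof -
  have z: "Im z \<noteq> 0"
    using assms(14) by (simp add: complex_is_Real_iff)
  have sample: "gaussian_sample (M m) (n m) (T m) (\<Sigma> m) (X m) z" if "m \<ge> 1" for m
    using assms(2,5,12,13)[OF that] z by (intro gaussian_sample.intro gaussian_sample_axioms.intro)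
  let ?Z = "\<lambda>m. gaussian_sample.error_term (n m) (T m) (\<Sigma> m) (X m) z"
  have Z: "L_fun (T m) (\<Sigma> m) (X m \<omega>) z - (1 - 1 / (1 - complex_of_real (q m) + z * G_fun (T m) (X m \<omega>) z)) = ?Z m \<omega>"
    if "m \<ge> 1" for m \<omega>
    unfolding gaussian_sample.error_term_def[OF sample[OF that]] assms(8) ..
  obtain s where s: "s > 0" "\<And>m. op_norm (\<Sigma> m) \<le> s"
    using assms(10) unfolding Bseq_def by (metis abs_le_D1 real_norm_def)
  obtain c where c: "c > 0" "\<And>m. real (n m) / T m \<le> c"
    using assms(9) unfolding Bseq_def assms(8) by (metis abs_le_D1 real_norm_def)
  have lim: "(\<lambda>m. K / real (T m)) \<longlonglongrightarrow> 0" for K :: real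
    by (intro real_tendsto_divide_at_top[OF tendsto_const] filterlim_compose[OF filterlim_real_sequentially assms(4)])
  have "(\<lambda>m. measure (M m) {\<omega> \<in> space (M m). cmod (L_fun (T m) (\<Sigma> m) (X m \<omega>) z -
           (1 - 1 / (1 - complex_of_real (q m) + z * G_fun (T m) (X m \<omega>) z))) > \<epsilon>}) \<longlonglongrightarrow> 0" if \<epsilon>: "\<epsilon> > 0" for \<epsilon>
  proof -
    \<comment> \<open>\<open>inverse_perturbation\<close> asks for \<eta> \<le> 1/2. The other value
      makes 2 \<eta> (1 + |L|) \<le> \<epsilon>, as s c / |Im z| bounds |L|.\<close>
    define \<eta> where "\<eta> = min (1 / 2) (\<epsilon> / (2 * (1 + s * c / \<bar>Im z\<bar>)))"
    define \<delta> where "\<delta> = \<eta> / 2 * (\<bar>Im z\<bar> / cmod z)"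
    have pos: "1 + s * c / \<bar>Im z\<bar> > 0" using s c by (intro add_pos_nonneg) auto
    have "\<epsilon> / (2 * (1 + s * c / \<bar>Im z\<bar>)) > 0"
      using \<epsilon> pos by (intro divide_pos_pos mult_pos_pos) simp_all
    then have \<eta>0: "\<eta> > 0"
      unfolding \<eta>_def min_less_iff_conj by simp
    have "\<eta> \<le> 1 / 2"
      unfolding \<eta>_def by (rule min.cobounded1)
    note \<eta> = \<eta>0 this
    have "z \<noteq> 0" using z by auto
    then have \<delta>: "\<delta> > 0" using \<eta> z by (simp add: \<delta>_def)
    have "\<eta> \<le> \<epsilon> / (2 * (1 + s * c / \<bar>Im z\<bar>))"
      unfolding \<eta>_def by (rule min.cobounded2)
    then have "\<eta> * (2 * (1 + s * c / \<bar>Im z\<bar>)) \<le> \<epsilon>"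
      using pos by (subst (asm) pos_le_divide_eq) simp_all
    then have \<eta>\<epsilon>: "2 * \<eta> * (1 + s * c / \<bar>Im z\<bar>) \<le> \<epsilon>"
      by (simp add: mult_ac)
    have "eventually (\<lambda>m. (s / \<bar>Im z\<bar>) / real (T m) < \<delta>) sequentially"
      using \<delta> by (rule order_tendstoD(2)[OF lim])
    then have "eventually (\<lambda>m. measure (M m) {\<omega> \<in> space (M m). cmod (L_fun (T m) (\<Sigma> m) (X m \<omega>) z -
           (1 - 1 / (1 - complex_of_real (q m) + z * G_fun (T m) (X m \<omega>) z))) > \<epsilon>}
        \<le> (2 * s\<^sup>2 * c / ((Im z)\<^sup>2 * \<delta>\<^sup>2)) / real (T m)) sequentially"
      \<comment> \<open>Index 0 is excluded, since the hypotheses on the sample start at 1.\<close>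
      using eventually_ge_at_top[of 1]
    proof eventually_elim
      case (elim m)
      interpret gaussian_sample "M m" "n m" "T m" "\<Sigma> m" "X m" z by (rule sample[OF elim(2)])
      have op: "0 \<le> op_norm (\<Sigma> m)" "op_norm (\<Sigma> m) \<le> s" by (rule op_norm_nonneg) (rule s)
      have "op_norm (\<Sigma> m) / (\<bar>Im z\<bar> * T m) \<le> s / (\<bar>Im z\<bar> * T m)"
        using op by (intro divide_right_mono) auto
      then have large: "op_norm (\<Sigma> m) / (\<bar>Im z\<bar> * T m) \<le> \<eta> / 2 * (\<bar>Im z\<bar> / cmod z)"
        using elim(1) by (simp add: \<delta>_def)
      have "op_norm (\<Sigma> m) * (n m / T m) / \<bar>Im z\<bar> \<le> s * c / \<bar>Im z\<bar>"
        using op c s by (intro divide_right_mono mult_mono) auto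
      then have "op_norm (\<Sigma> m) * n m / (\<bar>Im z\<bar> * T m) \<le> s * c / \<bar>Im z\<bar>"
        by (simp add: mult.commute)
      then have "2 * \<eta> * (1 + op_norm (\<Sigma> m) * n m / (\<bar>Im z\<bar> * T m)) \<le> 2 * \<eta> * (1 + s * c / \<bar>Im z\<bar>)"
        using \<eta> by (intro mult_left_mono) auto
      then have "prob {\<omega> \<in> space (M m). cmod (error_term \<omega>) > \<epsilon>} \<le> 2 * (op_norm (\<Sigma> m))\<^sup>2 * n m / ((Im z)\<^sup>2 * (T m)\<^sup>2 * \<delta>\<^sup>2)"
        unfolding \<delta>_def using \<eta>\<epsilon> by (intro error_term_prob[OF \<eta> large]) linarith
      \<comment> \<open>One factor 1/T is paired with n, where c bounds the ratio; the other one
        gives the rate.\<close>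
      also have "\<dots> = (2 * (op_norm (\<Sigma> m))\<^sup>2 * (n m / T m) / ((Im z)\<^sup>2 * \<delta>\<^sup>2)) / T m"
        by (simp add: power2_eq_square[of "real (T m)"] mult_ac)
      also have "\<dots> \<le> (2 * s\<^sup>2 * c / ((Im z)\<^sup>2 * \<delta>\<^sup>2)) / T m"
        using op c s by (intro divide_right_mono mult_mono power_mono) auto
      finally show ?case unfolding Z[OF elim(2)] .
    qed
    then show ?thesis
      by (rule tendsto_sandwich[OF always_eventually _ tendsto_const lim, rotated]) simp
  qed
  moreover have "(\<lambda>\<omega>. L_fun (T m) (\<Sigma> m) (X m \<omega>) z -
           (1 - 1 / (1 - complex_of_real (q m) + z * G_fun (T m) (X m \<omega>) z))) \<in> borel_measurable (M m)" if "m \<ge> 1" for m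
    unfolding Z[OF that] using gaussian_sample.measurable_error_term[OF sample[OF that]] by simp
  ultimately show ?thesis
    unfolding tendsto_zero_in_prob_def by blast
qed

end
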